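(* Let $G=(G^0,G^1,\mathrm{s},\mathrm{t})$ be a directed graph with no infinite receivers. Let $d:G^0\sqcup G^1\to\mathbb{N}$ be a function such that for each vertex $v\in G^0$ we have $d(v)=\sup_{e\in\mathrm{t}^{-1}(v)}d(e)$ if $v$ is not a source, and $d(v)=0$ if $v$ is a source. Let $G_{\mathrm{id},d}$ be the in-delay of $G$ determined by $d$. For each category $\mathsf{C}$ with binary coproducts there is an equivalence of categories $$\mathsf{Diag}^{\sqcup}_{\mathsf{C}}(G)\cong \mathsf{Diag}^{\sqcup}_{\mathsf{C}}(G_{\mathrm{id},d}).$$
   Context: A directed graph $G=(G^0,G^1,\mathrm{s},\mathrm{t})$ consists of a nonempty set $G^0$ of vertices, a set $G^1$ of edges, and source and target maps $\mathrm{s},\mathrm{t}:G^1\to G^0$ (the sets may be infinite). A vertex $v$ is a source if $\mathrm{t}^{-1}(v)=\emptyset$, and an infinite receiver if $\mathrm{t}^{-1}(v)$ is infinite. Here $\mathbb{N}=\{0,1,2,\dots\}$. The in-delay $G_{\mathrm{id},d}=(G_{\mathrm{id},d}^0,G_{\mathrm{id},d}^1,\mathrm{s}_{\mathrm{id},d},\mathrm{t}_{\mathrm{id},d})$ is the directed graph with $G_{\mathrm{id},d}^0=\{(v,n)\mid v\in G^0,\ n\in\mathbb{N},\ 0\le n\le d(v)\}$, $G_{\mathrm{id},d}^1=G^1\sqcup\{e_{v,n}\mid v\in G^0,\ n\in\mathbb{N},\ 1\le n\le d(v)\}$, $\mathrm{s}_{\mathrm{id},d}(e)=(\mathrm{s}(e),0)$,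 $\mathrm{s}_{\mathrm{id},d}(e_{v,n})=(v,n)$, $\mathrm{t}_{\mathrm{id},d}(e)=(\mathrm{t}(e),d(e))$, $\mathrm{t}_{\mathrm{id},d}(e_{v,n})=(v,n-1)$. A category has binary coproducts if every pair of objects has a coproduct (equivalently, every family of objects indexed by a finite nonempty set has a coproduct). For a category $\mathsf{C}$, a diagram $D$ in $\mathsf{C}$ of shape $G$ consists of an object $D_v$ of $\mathsf{C}$ for each $v\in G^0$ and a morphism $D_e:D_{\mathrm{s}(e)}\to D_{\mathrm{t}(e)}$ for each $e\in G^1$. A morphism $T:D\to E$ consists of morphisms $T_v:D_v\to E_v$ ($v\in G^0$) with $T_{\mathrm{t}(e)}\circ D_e=E_e\circ T_{\mathrm{s}(e)}$ for all $e\in G^1$. The diagram $D$ satisfies the coproduct condition if for every vertex $v$ that is not a source, the family of morphisms $(D_e:D_{\mathrm{s}(e)}\to D_v\mid e\in \mathrm{t}^{-1}(v))$ makes $D_v$ a coproduct in $\mathsf{C}$ of the family $(D_{\mathrm{s}(e)}\mid e\in \mathrm{t}^{-1}(v))$. $\mathsf{Diag}^{\sqcup}_{\mathsf{C}}(G)$ is the category of diagrams in $\mathsf{C}$ of shape $G$ satisfying the coproduct condition, with all morphisms of diagrams between them. *)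

theory Defs
  imports "HOL-Library.FuncSet" "Graph_Theory.Digraph"
begin

section \<open>Categories, functors, equivalences\<close>

record ('o, 'm) precategory =
  Ob :: "'o set"
  Arr :: "'m set"
  Dom :: "'m \<Rightarrow> 'o"
  Cod :: "'m \<Rightarrow> 'o"
  Ident :: "'o \<Rightarrow> 'm"
  Comp :: "'m \<Rightarrow> 'm \<Rightarrow> 'm" (infixr "\<cdot>\<index>" 70)

definition Hom :: "('o, 'm) precategory \<Rightarrow> 'o \<Rightarrow> 'o \<Rightarrow> 'm set" where
  "Hom C a b = {f \<in> Arr C. Dom C f = a \<and> Cod C f = b}"

text \<open>Composition is in applicative order: \<open>g \<cdot> f\<close> is ``first \<open>f\<close>, then \<open>g\<close>'', and
  is only meaningful when \<open>Dom g = Cod f\<close>.\<close>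

locale category =
  fixes C :: "('o, 'm) precategory" (structure)
  assumes Dom_in_Ob: "f \<in> Arr C \<Longrightarrow> Dom C f \<in> Ob C"
    and Cod_in_Ob: "f \<in> Arr C \<Longrightarrow> Cod C f \<in> Ob C"
    and Ident_in_Hom: "a \<in> Ob C \<Longrightarrow> Ident C a \<in> Hom C a a"
    and Comp_in_Hom: "\<lbrakk>f \<in> Hom C a b; g \<in> Hom C b c\<rbrakk> \<Longrightarrow> g \<cdot> f \<in> Hom C a c"
    and Comp_Ident: "f \<in> Hom C a b \<Longrightarrow> f \<cdot> Ident C a = f"
    and Ident_Comp: "f \<in> Hom C a b \<Longrightarrow> Ident C b \<cdot> f = f"
    and Comp_assoc: "\<lbrakk>f \<in> Hom C a b; g \<in> Hom C b c; h \<in> Hom C c d\<rbrakk>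
      \<Longrightarrow> (h \<cdot> g) \<cdot> f = h \<cdot> (g \<cdot> f)"

locale cat_functor = C: category C + D: category D
  for C :: "('o1, 'm1) precategory" and D :: "('o2, 'm2) precategory"
    and Fo :: "'o1 \<Rightarrow> 'o2" and Fa :: "'m1 \<Rightarrow> 'm2" +
  assumes F_Ob: "a \<in> Ob C \<Longrightarrow> Fo a \<in> Ob D"
    and F_Hom: "f \<in> Hom C a b \<Longrightarrow> Fa f \<in> Hom D (Fo a) (Fo b)"
    and F_Ident: "a \<in> Ob C \<Longrightarrow> Fa (Ident C a) = Ident D (Fo a)"
    and F_Comp: "\<lbrakk>f \<in> Hom C a b; g \<in> Hom C b c\<rbrakk>
      \<Longrightarrow> Fa (g \<cdot>\<^bsub>C\<^esub> f) = Fa g \<cdot>\<^bsub>D\<^esub> Fa f"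

definition is_iso :: "('o, 'm) precategory \<Rightarrow> 'm \<Rightarrow> bool" where
  "is_iso C f \<longleftrightarrow> f \<in> Arr C \<and>
     (\<exists>g \<in> Hom C (Cod C f) (Dom C f).
        Comp C g f = Ident C (Dom C f) \<and> Comp C f g = Ident C (Cod C f))"

locale natural_iso = F: cat_functor C D Fo Fa + G: cat_functor C D Go Ga
  for C :: "('o1, 'm1) precategory" and D :: "('o2, 'm2) precategory"
    and Fo :: "'o1 \<Rightarrow> 'o2" and Fa :: "'m1 \<Rightarrow> 'm2"
    and Go :: "'o1 \<Rightarrow> 'o2" and Ga :: "'m1 \<Rightarrow> 'm2"
    and \<eta> :: "'o1 \<Rightarrow> 'm2" +
  assumes component_Hom: "a \<in> Ob C \<Longrightarrow> \<eta> a \<in> Hom D (Fo a) (Go a)"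
    and component_iso: "a \<in> Ob C \<Longrightarrow> is_iso D (\<eta> a)"
    and naturality: "f \<in> Hom C a b \<Longrightarrow> \<eta> b \<cdot>\<^bsub>D\<^esub> Fa f = Ga f \<cdot>\<^bsub>D\<^esub> \<eta> a"

definition equivalent_categories ::
    "('o1, 'm1) precategory \<Rightarrow> ('o2, 'm2) precategory \<Rightarrow> bool" where
  "equivalent_categories C D \<longleftrightarrow>
     (\<exists>Fo Fa Go Ga \<eta> \<epsilon>.
        cat_functor C D Fo Fa \<and> cat_functor D C Go Ga \<and>
        natural_iso C C id id (Go \<circ> Fo) (Ga \<circ> Fa) \<eta> \<and>
        natural_iso D D (Fo \<circ> Go) (Fa \<circ> Ga) id id \<epsilon>)"

section \<open>Coproducts\<close>

definition is_coproduct ::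
    "('o, 'm) precategory \<Rightarrow> 'i set \<Rightarrow> ('i \<Rightarrow> 'o) \<Rightarrow> 'o \<Rightarrow> ('i \<Rightarrow> 'm) \<Rightarrow> bool" where
  "is_coproduct C I X c \<iota> \<longleftrightarrow>
     c \<in> Ob C \<and> (\<forall>i\<in>I. X i \<in> Ob C \<and> \<iota> i \<in> Hom C (X i) c) \<and>
     (\<forall>z\<in>Ob C. \<forall>f. (\<forall>i\<in>I. f i \<in> Hom C (X i) z) \<longrightarrow>
        (\<exists>!h. h \<in> Hom C c z \<and> (\<forall>i\<in>I. Comp C h (\<iota> i) = f i)))"

definition has_binary_coproducts :: "('o, 'm) precategory \<Rightarrow> bool" where
  "has_binary_coproducts C \<longleftrightarrow>
     (\<forall>a\<in>Ob C. \<forall>b\<in>Ob C. \<exists>c \<iota>.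
        is_coproduct C (UNIV :: bool set) (\<lambda>i. if i then a else b) c \<iota>)"

section \<open>Diagrams of the shape of a directed graph\<close>

record ('v, 'e, 'o, 'm) diagram =
  D_vert :: "'v \<Rightarrow> 'o"
  D_arc :: "'e \<Rightarrow> 'm"

text \<open>Families indexed by the vertices or arcs of a graph are extensional functions, so
  that equality of diagrams and of their morphisms only depends on the values on the graph.\<close>

definition is_diagram ::
    "('o, 'm) precategory \<Rightarrow> ('v, 'e) pre_digraph \<Rightarrow> ('v, 'e, 'o, 'm) diagram \<Rightarrow> bool" where
  "is_diagram C G D \<longleftrightarrow>
     D_vert D \<in> verts G \<rightarrow>\<^sub>E Ob C \<and>
     D_arc D \<in> (\<Pi>\<^sub>E e\<in>arcs G. Hom C (D_vert D (tail G e)) (D_vert D (head G e)))"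

definition coproduct_condition ::
    "('o, 'm) precategory \<Rightarrow> ('v, 'e) pre_digraph \<Rightarrow> ('v, 'e, 'o, 'm) diagram \<Rightarrow> bool" where
  "coproduct_condition C G D \<longleftrightarrow>
     (\<forall>v\<in>verts G. in_arcs G v \<noteq> {} \<longrightarrow>
        is_coproduct C (in_arcs G v) (\<lambda>e. D_vert D (tail G e)) (D_vert D v) (D_arc D))"

definition is_diagram_morphism ::
    "('o, 'm) precategory \<Rightarrow> ('v, 'e) pre_digraph \<Rightarrow> ('v, 'e, 'o, 'm) diagram
      \<Rightarrow> ('v, 'e, 'o, 'm) diagram \<Rightarrow> ('v \<Rightarrow> 'm) \<Rightarrow> bool" where
  "is_diagram_morphism C G D E T \<longleftrightarrow>
     T \<in> (\<Pi>\<^sub>E v\<in>verts G. Hom C (D_vert D v) (D_vert E v)) \<and>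
     (\<forall>e\<in>arcs G. Comp C (T (head G e)) (D_arc D e) = Comp C (D_arc E e) (T (tail G e)))"

text \<open>An arrow \<open>(D, T, E)\<close> is a morphism of diagrams \<open>T\<close> tagged with its domain \<open>D\<close> and its
  codomain \<open>E\<close>.\<close>

definition Diag_coprod ::
    "('o, 'm) precategory \<Rightarrow> ('v, 'e) pre_digraph \<Rightarrow>
     (('v, 'e, 'o, 'm) diagram,
      ('v, 'e, 'o, 'm) diagram \<times> ('v \<Rightarrow> 'm) \<times> ('v, 'e, 'o, 'm) diagram) precategory" where
  "Diag_coprod C G =
     (let Obs = {D. is_diagram C G D \<and> coproduct_condition C G D} in
      \<lparr> Ob = Obs,
        Arr = {(D, T, E). D \<in> Obs \<and> E \<in> Obs \<and> is_diagram_morphism C G D E T},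
        Dom = (\<lambda>(D, T, E). D),
        Cod = (\<lambda>(D, T, E). E),
        Ident = (\<lambda>D. (D, (\<lambda>v\<in>verts G. Ident C (D_vert D v)), D)),
        Comp = (\<lambda>(D', S, E) (D, T, D''). (D, (\<lambda>v\<in>verts G. Comp C (S v) (T v)), E)) \<rparr>)"

section \<open>In-delays\<close>

text \<open>The map \<open>d\<close> on the disjoint union of vertices and arcs takes vertices as \<open>Inl v\<close> and
  arcs as \<open>Inr e\<close>.  The arcs of the in-delay are the arcs \<open>Inl e\<close> inherited from \<open>G\<close> and the
  new arcs \<open>Inr (v, n)\<close>, usually written \<open>e\<close> with index \<open>v, n\<close>.\<close>

definition in_delay ::
    "('v, 'e) pre_digraph \<Rightarrow> ('v + 'e \<Rightarrow> nat) \<Rightarrow> ('v \<times> nat, 'e + 'v \<times> nat) pre_digraph" where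
  "in_delay G d =
     \<lparr> verts = {(v, n). v \<in> verts G \<and> n \<le> d (Inl v)},
       arcs = Inl ` arcs G \<union> Inr ` {(v, n). v \<in> verts G \<and> 1 \<le> n \<and> n \<le> d (Inl v)},
       tail = case_sum (\<lambda>e. (tail G e, 0)) (\<lambda>(v, n). (v, n)),
       head = case_sum (\<lambda>e. (head G e, d (Inr e))) (\<lambda>(v, n). (v, n - 1)) \<rparr>"

section \<open>Well-formedness\<close>

lemma (in category) category_Diag_coprod:
  assumes "wf_digraph G"
  shows "category (Diag_coprod C G)"
proof -
  interpret G: wf_digraph G by fact
  have wd: "D_vert D v \<in> Ob C" if "is_diagram C G D" "v \<in> verts G" for D v
    using that by (auto simp: is_diagram_def)
  have ad: "D_arc D e \<in> Hom C (D_vert D (tail G e)) (D_vert D (head G e))"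
    if "is_diagram C G D" "e \<in> arcs G" for D e
    using that by (auto simp: is_diagram_def)
  have md: "T v \<in> Hom C (D_vert D v) (D_vert E v)"
    if "is_diagram_morphism C G D E T" "v \<in> verts G" for D E T v
    using that by (auto simp: is_diagram_morphism_def)
  have ext: "T \<in> extensional (verts G)" if "is_diagram_morphism C G D E T" for D E T
    using that by (auto simp: is_diagram_morphism_def PiE_def)
  have ident: "is_diagram_morphism C G D D (\<lambda>v\<in>verts G. Ident C (D_vert D v))"
    if D: "is_diagram C G D" for D
    using Comp_Ident[OF ad[OF D]] Ident_Comp[OF ad[OF D]]
    by (auto simp: is_diagram_morphism_def intro: Ident_in_Hom wd[OF D])
  have comp: "is_diagram_morphism C G D F (\<lambda>v\<in>verts G. Comp C (S v) (T v))"
    if D: "is_diagram C G D" and E: "is_diagram C G E" and F: "is_diagram C G F"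
      and T: "is_diagram_morphism C G D E T" and S: "is_diagram_morphism C G E F S" for D E F S T
  proof -
    have "Comp C (Comp C (S (head G e)) (T (head G e))) (D_arc D e)
        = Comp C (D_arc F e) (Comp C (S (tail G e)) (T (tail G e)))" if e: "e \<in> arcs G" for e
    proof -
      have t: "tail G e \<in> verts G" and h: "head G e \<in> verts G"
        using e by simp_all
      have nT: "Comp C (T (head G e)) (D_arc D e) = Comp C (D_arc E e) (T (tail G e))"
        using T e by (simp add: is_diagram_morphism_def)
      have nS: "Comp C (S (head G e)) (D_arc E e) = Comp C (D_arc F e) (S (tail G e))"
        using S e by (simp add: is_diagram_morphism_def)
      show ?thesis
        using Comp_assoc[OF ad[OF D e] md[OF T h] md[OF S h]]
          Comp_assoc[OF md[OF T t] ad[OF E e] md[OF S h]]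
          Comp_assoc[OF md[OF T t] md[OF S t] ad[OF F e]] nT nS
        by simp
    qed
    then show ?thesis
      by (auto simp: is_diagram_morphism_def intro: Comp_in_Hom[OF md[OF T] md[OF S]])
  qed
  show ?thesis
  proof (unfold_locales, goal_cases)
    case 1 then show ?case by (auto simp: Diag_coprod_def)
  next
    case 2 then show ?case by (auto simp: Diag_coprod_def)
  next
    case 3 then show ?case using ident by (auto simp: Diag_coprod_def Hom_def Let_def)
  next
    case 4 then show ?case using comp by (auto simp: Diag_coprod_def Hom_def Let_def)
  next
    case (5 f a b)
    then obtain T where f: "f = (a, T, b)" and T: "is_diagram_morphism C G a b T"
      by (auto simp: Diag_coprod_def Hom_def Let_def)
    have "(\<lambda>v\<in>verts G. Comp C (T v) ((\<lambda>v\<in>verts G. Ident C (D_vert a v)) v)) = T"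
      by (rule extensionalityI[OF _ ext[OF T]]) (auto simp: Comp_Ident[OF md[OF T]])
    then show ?case by (simp add: f Diag_coprod_def)
  next
    case (6 f a b)
    then obtain T where f: "f = (a, T, b)" and T: "is_diagram_morphism C G a b T"
      by (auto simp: Diag_coprod_def Hom_def Let_def)
    have "(\<lambda>v\<in>verts G. Comp C ((\<lambda>v\<in>verts G. Ident C (D_vert b v)) v) (T v)) = T"
      by (rule extensionalityI[OF _ ext[OF T]]) (auto simp: Ident_Comp[OF md[OF T]])
    then show ?case by (simp add: f Diag_coprod_def)
  next
    case (7 f a b g c h d)
    then obtain R S T where "f = (a, R, b)" "g = (b, S, c)" "h = (c, T, d)"
      and m: "is_diagram_morphism C G a b R" "is_diagram_morphism C G b c S"
        "is_diagram_morphism C G c d T"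
      by (auto simp: Diag_coprod_def Hom_def Let_def)
    then show ?case
      using Comp_assoc[OF md[OF m(1)] md[OF m(2)] md[OF m(3)]]
      by (auto simp: Diag_coprod_def intro!: restrict_ext)
  qed
qed

lemma (in wf_digraph) wf_digraph_in_delay:
  assumes "\<And>e. e \<in> arcs G \<Longrightarrow> d (Inr e) \<le> d (Inl (head G e))"
  shows "wf_digraph (in_delay G d)"
  using assms by unfold_locales (auto simp: in_delay_def)

end

theory Submission
  imports Defs
begin

text \<open>
  In the in-delay, the vertex \<open>v\<close> is replaced by the path
  \<open>(v, d v) \<rightarrow> \<dots> \<rightarrow> (v, 1) \<rightarrow> (v, 0)\<close>; an arc \<open>e\<close> of \<open>G\<close> with head \<open>v\<close> enters it at
  \<open>(v, d e)\<close>, and every arc of \<open>G\<close> leaves from level \<open>0\<close>.  For a diagram \<open>E\<close> over the in-delay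
  and an arc \<open>e\<close> with \<open>n \<le> d e\<close>, composing \<open>E\<close> along \<open>e\<close> and then down the path to \<open>(v, n)\<close>
  gives a morphism \<open>leg E e n\<close> from \<open>E\<close> at the tail of \<open>e\<close> to \<open>E\<close> at \<open>(v, n)\<close>.

  The arcs entering \<open>(v, n)\<close> are the arcs of delay exactly \<open>n\<close> and the path arc from
  \<open>(v, n + 1)\<close>.  Since a coproduct one of whose summands is itself a coproduct is a coproduct of
  the merged family (\<open>nested_coproduct_iff\<close>), descending from the top of each path shows that
  \<open>E\<close> satisfies the coproduct condition iff, for every \<open>v\<close> that is not a source and every
  \<open>n \<le> d v\<close>, the legs at level \<open>n\<close> make \<open>E\<close> at \<open>(v, n)\<close> a coproduct over all arcs of delay at
  least \<open>n\<close> (\<open>coproduct_condition_H_iff\<close>).  The supremum being attained enters here: without an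
  arc of delay \<open>d v\<close> the top of the path would be a source, exempt from the condition, although
  \<open>v\<close> is not.

  Level \<open>0\<close> of this statement says that forgetting the higher levels, while composing along the
  paths, is a functor \<open>collapse\<close> to the diagrams over \<open>G\<close> with the coproduct condition.  It is
  \<^item> fully faithful, because a morphism is forced on each level by its values at level \<open>0\<close> and
    the universal property of the coproduct at that level (\<open>delay_morphism_eqI\<close>,
    \<open>delay_morphism_exists\<close>);
  \<^item> surjective on objects, because the missing objects at positive levels can be chosen as
    coproducts of finite nonempty families, which binary coproducts provide
    (\<open>collapse_surjective\<close>).

  A fully faithful functor that is surjective on objects is half of an equivalence.
\<close>

section \<open>Fully faithful functors that are surjective on objects\<close>

lemma HomD:
  assumes "f \<in> Hom C a b"
  shows "f \<in> Arr C" "Dom C f = a" "Cod C f = b"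
  using assms by (auto simp: Hom_def)

lemma (in category) Hom_Ob:
  assumes "f \<in> Hom C a b"
  shows "a \<in> Ob C" "b \<in> Ob C"
  using assms Dom_in_Ob Cod_in_Ob by (auto simp: Hom_def)

lemma is_isoI:
  assumes "f \<in> Hom C a b" "g \<in> Hom C b a" "Comp C g f = Ident C a" "Comp C f g = Ident C b"
  shows "is_iso C f"
  using assms HomD[OF assms(1)] unfolding is_iso_def by auto

lemma (in category) is_iso_Ident:
  assumes "a \<in> Ob C"
  shows "is_iso C (Ident C a)"
  using is_isoI[OF Ident_in_Hom[OF assms] Ident_in_Hom[OF assms]]
    Comp_Ident[OF Ident_in_Hom[OF assms]] by simp

text \<open>A choice of preimages of objects extends to a functor in the opposite direction: an
  arrow is sent to its unique preimage between the chosen objects.  One composite of the two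
  functors is then the identity of \<open>B\<close>; the other is isomorphic to the identity of \<open>A\<close> through
  the preimages of identity arrows, since \<open>a\<close> and the object chosen for \<open>Fo a\<close> have the same
  image.\<close>

lemma equivalent_categories_if_surjective_fully_faithful:
  fixes A :: "('o1, 'm1) precategory" and B :: "('o2, 'm2) precategory"
  assumes F: "cat_functor A B Fo Fa"
    and ff: "\<And>a a'. a \<in> Ob A \<Longrightarrow> a' \<in> Ob A \<Longrightarrow> bij_betw Fa (Hom A a a') (Hom B (Fo a) (Fo a'))"
    and surj: "\<And>b. b \<in> Ob B \<Longrightarrow> \<exists>a\<in>Ob A. Fo a = b"
  shows "equivalent_categories B A"
proof -
  interpret F: cat_functor A B Fo Fa by fact
  define lift where "lift a a' = inv_into (Hom A a a') Fa" for a a'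
  have lift: "lift a a' g \<in> Hom A a a'" "Fa (lift a a' g) = g"
    if "a \<in> Ob A" "a' \<in> Ob A" "g \<in> Hom B (Fo a) (Fo a')" for a a' g
    using bij_betw_imp_surj_on[OF ff[OF that(1,2)]] that(3)
      inv_into_into[of g Fa "Hom A a a'"] f_inv_into_f[of g Fa "Hom A a a'"]
    by (auto simp: lift_def)
  have eqI: "f = g" if "f \<in> Hom A a a'" "g \<in> Hom A a a'" "Fa f = Fa g" for f g a a'
    using bij_betw_imp_inj_on[OF ff[OF F.C.Hom_Ob[OF that(1)]]] that by (auto dest: inj_onD)
  obtain Go where Go: "Go b \<in> Ob A" "Fo (Go b) = b" if "b \<in> Ob B" for b
    using surj by metis
  define Ga where "Ga g = lift (Go (Dom B g)) (Go (Cod B g)) g" for g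
  have Ga: "Ga g \<in> Hom A (Go b) (Go b')" "Fa (Ga g) = g" if "g \<in> Hom B b b'" for g b b'
    using lift[of "Go b" "Go b'" g] Go F.D.Hom_Ob[OF that] HomD[OF that] that
    by (auto simp: Ga_def)
  have G: "cat_functor B A Go Ga"
  proof unfold_locales
    fix b assume b: "b \<in> Ob B"
    show "Go b \<in> Ob A" using Go b by simp
    note i = F.D.Ident_in_Hom[OF b]
    show "Ga (Ident B b) = Ident A (Go b)"
      by (rule eqI[OF Ga(1)[OF i] F.C.Ident_in_Hom[OF Go(1)[OF b]]])
        (simp add: Ga(2)[OF i] F.F_Ident Go b)
  next
    fix f b b' g b''
    assume f: "f \<in> Hom B b b'"
    show "Ga f \<in> Hom A (Go b) (Go b')" using Ga f by simp
    assume g: "g \<in> Hom B b' b''"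
    show "Ga (Comp B g f) = Comp A (Ga g) (Ga f)"
      by (rule eqI[OF Ga(1)[OF F.D.Comp_in_Hom[OF f g]] F.C.Comp_in_Hom[OF Ga(1)[OF f] Ga(1)[OF g]]])
        (simp add: F.F_Comp[OF Ga(1)[OF f] Ga(1)[OF g]] Ga(2)[OF f] Ga(2)[OF g]
          Ga(2)[OF F.D.Comp_in_Hom[OF f g]])
  qed
  interpret G: cat_functor B A Go Ga by fact
  have "natural_iso B B id id (Fo \<circ> Go) (Fa \<circ> Ga) (Ident B)"
  proof unfold_locales
    fix a assume a: "a \<in> Ob B"
    show "(Fo \<circ> Go) a \<in> Ob B" using Go a by simp
    show "(Fa \<circ> Ga) (Ident B a) = Ident B ((Fo \<circ> Go) a)"
      using Go(2)[OF a] Ga(2)[OF F.D.Ident_in_Hom[OF a]] by simp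
    show "Ident B a \<in> Hom B (id a) ((Fo \<circ> Go) a)"
      using Go(2)[OF a] F.D.Ident_in_Hom[OF a] by simp
    show "is_iso B (Ident B a)" using F.D.is_iso_Ident[OF a] .
  next
    fix f a b assume f: "f \<in> Hom B a b"
    note ob = F.D.Hom_Ob[OF f]
    show "(Fa \<circ> Ga) f \<in> Hom B ((Fo \<circ> Go) a) ((Fo \<circ> Go) b)"
      using Ga(2)[OF f] Go(2) ob f by simp
    show "Comp B (Ident B b) (id f) = Comp B ((Fa \<circ> Ga) f) (Ident B a)"
      using Ga(2)[OF f] F.D.Comp_Ident[OF f] F.D.Ident_Comp[OF f] by simp
    fix g c assume g: "g \<in> Hom B b c"
    show "(Fa \<circ> Ga) (Comp B g f) = Comp B ((Fa \<circ> Ga) g) ((Fa \<circ> Ga) f)"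
      using Ga(2)[OF f] Ga(2)[OF g] Ga(2)[OF F.D.Comp_in_Hom[OF f g]] by simp
  qed auto
  moreover
  define \<epsilon> where "\<epsilon> a = lift (Go (Fo a)) a (Ident B (Fo a))" for a
  have GF: "Go (Fo a) \<in> Ob A" "Fo (Go (Fo a)) = Fo a" if "a \<in> Ob A" for a
    using Go F.F_Ob that by auto
  have \<epsilon>: "\<epsilon> a \<in> Hom A (Go (Fo a)) a" "Fa (\<epsilon> a) = Ident B (Fo a)" if "a \<in> Ob A" for a
    using lift[of "Go (Fo a)" a] GF[OF that] that F.D.Ident_in_Hom[OF F.F_Ob[OF that]]
    by (auto simp: \<epsilon>_def)
  have "natural_iso A A (Go \<circ> Fo) (Ga \<circ> Fa) id id \<epsilon>"
  proof unfold_locales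
    fix a assume a: "a \<in> Ob A"
    show "(Go \<circ> Fo) a \<in> Ob A" using GF a by simp
    show "(Ga \<circ> Fa) (Ident A a) = Ident A ((Go \<circ> Fo) a)"
      using F.F_Ident[OF a] G.F_Ident[OF F.F_Ob[OF a]] by simp
    show "\<epsilon> a \<in> Hom A ((Go \<circ> Fo) a) (id a)" using \<epsilon>[OF a] by simp
    note i = F.D.Ident_in_Hom[OF F.F_Ob[OF a]]
    \<comment> \<open>Both \<open>\<epsilon> a\<close> and \<open>\<delta>\<close> lie over the identity of \<open>Fo a\<close>, so faithfulness makes them inverse.\<close>
    define \<delta> where "\<delta> = lift a (Go (Fo a)) (Ident B (Fo a))"
    have \<delta>: "\<delta> \<in> Hom A a (Go (Fo a))" "Fa \<delta> = Ident B (Fo a)"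
      using lift[of a "Go (Fo a)"] GF[OF a] a i by (auto simp: \<delta>_def)
    show "is_iso A (\<epsilon> a)"
    proof (rule is_isoI[OF \<epsilon>(1)[OF a] \<delta>(1)])
      show "Comp A \<delta> (\<epsilon> a) = Ident A (Go (Fo a))"
        by (rule eqI[OF F.C.Comp_in_Hom[OF \<epsilon>(1)[OF a] \<delta>(1)] F.C.Ident_in_Hom[OF GF(1)[OF a]]])
          (simp add: F.F_Comp[OF \<epsilon>(1)[OF a] \<delta>(1)] \<epsilon>(2)[OF a] \<delta>(2) F.D.Comp_Ident[OF i]
            F.F_Ident[OF GF(1)[OF a]] GF(2)[OF a])
      show "Comp A (\<epsilon> a) \<delta> = Ident A a"
        by (rule eqI[OF F.C.Comp_in_Hom[OF \<delta>(1) \<epsilon>(1)[OF a]] F.C.Ident_in_Hom[OF a]])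
          (simp add: F.F_Comp[OF \<delta>(1) \<epsilon>(1)[OF a]] \<epsilon>(2)[OF a] \<delta>(2) F.D.Comp_Ident[OF i]
            F.F_Ident[OF a])
    qed
  next
    fix f a b assume f: "f \<in> Hom A a b"
    note ob = F.C.Hom_Ob[OF f] and Ff = F.F_Hom[OF f]
    note GFf = Ga[OF Ff]
    show "(Ga \<circ> Fa) f \<in> Hom A ((Go \<circ> Fo) a) ((Go \<circ> Fo) b)" using GFf by simp
    note l = F.C.Comp_in_Hom[OF GFf(1) \<epsilon>(1)[OF ob(2)]]
      and r = F.C.Comp_in_Hom[OF \<epsilon>(1)[OF ob(1)] f]
    have "Comp A (\<epsilon> b) (Ga (Fa f)) = Comp A f (\<epsilon> a)"
      by (rule eqI[OF l r])
        (simp add: F.F_Comp[OF GFf(1) \<epsilon>(1)[OF ob(2)]] F.F_Comp[OF \<epsilon>(1)[OF ob(1)] f]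
          \<epsilon>(2)[OF ob(1)] \<epsilon>(2)[OF ob(2)] GFf(2) F.D.Comp_Ident[OF Ff] F.D.Ident_Comp[OF Ff])
    then show "Comp A (\<epsilon> b) ((Ga \<circ> Fa) f) = Comp A (id f) (\<epsilon> a)" by simp
    fix g c assume g: "g \<in> Hom A b c"
    show "(Ga \<circ> Fa) (Comp A g f) = Comp A ((Ga \<circ> Fa) g) ((Ga \<circ> Fa) f)"
      using F.F_Comp[OF f g] G.F_Comp[OF Ff F.F_Hom[OF g]] by simp
  qed auto
  ultimately show ?thesis
    using F G unfolding equivalent_categories_def by blast
qed

section \<open>Coproducts\<close>

context category
begin

lemma coproduct_Ob:
  assumes "is_coproduct C I X c \<iota>"
  shows "c \<in> Ob C"
  using assms unfolding is_coproduct_def by (rule conjunct1)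

lemma coproduct_inj:
  assumes "is_coproduct C I X c \<iota>" "i \<in> I"
  shows "\<iota> i \<in> Hom C (X i) c"
proof -
  have "\<forall>i\<in>I. X i \<in> Ob C \<and> \<iota> i \<in> Hom C (X i) c"
    using assms(1) unfolding is_coproduct_def by (elim conjE)
  with assms(2) show ?thesis by blast
qed

lemma coproduct_ex1:
  assumes c: "is_coproduct C I X c \<iota>" and z: "z \<in> Ob C"
    and f: "\<And>i. i \<in> I \<Longrightarrow> f i \<in> Hom C (X i) z"
  shows "\<exists>!h. h \<in> Hom C c z \<and> (\<forall>i\<in>I. h \<cdot> \<iota> i = f i)"
proof -
  have "\<forall>z\<in>Ob C. \<forall>f. (\<forall>i\<in>I. f i \<in> Hom C (X i) z) \<longrightarrow>
      (\<exists>!h. h \<in> Hom C c z \<and> (\<forall>i\<in>I. h \<cdot> \<iota> i = f i))"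
    using c unfolding is_coproduct_def by (elim conjE)
  from this[THEN bspec, OF z, THEN spec, of f] f show ?thesis by (elim mp) (rule ballI)
qed

lemma coproduct_desc:
  assumes "is_coproduct C I X c \<iota>" "z \<in> Ob C" "\<And>i. i \<in> I \<Longrightarrow> f i \<in> Hom C (X i) z"
  obtains h where "h \<in> Hom C c z" "\<And>i. i \<in> I \<Longrightarrow> h \<cdot> \<iota> i = f i"
  using ex1_implies_ex[OF coproduct_ex1[OF assms]] by blast

lemma coproduct_eqI:
  assumes c: "is_coproduct C I X c \<iota>" and h: "h \<in> Hom C c z" and h': "h' \<in> Hom C c z"
    and eq: "\<And>i. i \<in> I \<Longrightarrow> h \<cdot> \<iota> i = h' \<cdot> \<iota> i"
  shows "h = h'"
proof -
  have "\<exists>!u. u \<in> Hom C c z \<and> (\<forall>i\<in>I. u \<cdot> \<iota> i = h' \<cdot> \<iota> i)"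
    by (rule coproduct_ex1[OF c Hom_Ob(2)[OF h] Comp_in_Hom[OF coproduct_inj[OF c] h']])
  then show ?thesis using h h' eq by blast
qed

lemma coproductI:
  assumes "c \<in> Ob C" and inj: "\<And>i. i \<in> I \<Longrightarrow> \<iota> i \<in> Hom C (X i) c"
    and ex: "\<And>z f. z \<in> Ob C \<Longrightarrow> (\<And>i. i \<in> I \<Longrightarrow> f i \<in> Hom C (X i) z) \<Longrightarrow>
      \<exists>h \<in> Hom C c z. \<forall>i\<in>I. h \<cdot> \<iota> i = f i"
    and un: "\<And>z h h'. h \<in> Hom C c z \<Longrightarrow> h' \<in> Hom C c z \<Longrightarrow>
      (\<And>i. i \<in> I \<Longrightarrow> h \<cdot> \<iota> i = h' \<cdot> \<iota> i) \<Longrightarrow> h = h'"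
  shows "is_coproduct C I X c \<iota>"
  unfolding is_coproduct_def
proof (intro conjI ballI allI impI)
  fix z f assume "z \<in> Ob C" "\<forall>i\<in>I. f i \<in> Hom C (X i) z"
  then obtain h where h: "h \<in> Hom C c z" "\<forall>i\<in>I. h \<cdot> \<iota> i = f i" using ex by blast
  show "\<exists>!h. h \<in> Hom C c z \<and> (\<forall>i\<in>I. h \<cdot> \<iota> i = f i)"
  proof (rule ex1I)
    show "h \<in> Hom C c z \<and> (\<forall>i\<in>I. h \<cdot> \<iota> i = f i)" using h by simp
    show "u = h" if u: "u \<in> Hom C c z \<and> (\<forall>i\<in>I. u \<cdot> \<iota> i = f i)" for u
    proof (rule un)
      show "u \<cdot> \<iota> i = h \<cdot> \<iota> i" if "i \<in> I" for i
        using u h(2) that by simp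
    qed (use u h(1) in blast)+
  qed
next
  show "c \<in> Ob C" by fact
  show "X i \<in> Ob C" "\<iota> i \<in> Hom C (X i) c" if "i \<in> I" for i
    using inj[OF that] Hom_Ob(1)[OF inj[OF that]] by simp_all
qed

lemma coproduct_reindex:
  assumes q: "inj_on q I" and "\<And>i. i \<in> I \<Longrightarrow> Y (q i) = X i" "\<And>i. i \<in> I \<Longrightarrow> \<kappa> (q i) = \<iota> i"
  shows "is_coproduct C (q ` I) Y c \<kappa> \<longleftrightarrow> is_coproduct C I X c \<iota>"
proof
  assume c: "is_coproduct C (q ` I) Y c \<kappa>"
  show "is_coproduct C I X c \<iota>"
  proof (rule coproductI)
    show "c \<in> Ob C" using coproduct_Ob[OF c] .
    show "\<iota> i \<in> Hom C (X i) c" if "i \<in> I" for i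
      using coproduct_inj[OF c, of "q i"] assms that by auto
    show "h = h'" if "h \<in> Hom C c z" "h' \<in> Hom C c z" "\<And>i. i \<in> I \<Longrightarrow> h \<cdot> \<iota> i = h' \<cdot> \<iota> i" for z h h'
      by (rule coproduct_eqI[OF c that(1,2)]) (use that(3) assms in auto)
    fix z f assume z: "z \<in> Ob C" and f: "\<And>i. i \<in> I \<Longrightarrow> f i \<in> Hom C (X i) z"
    have "f (inv_into I q j) \<in> Hom C (Y j) z" if "j \<in> q ` I" for j
      using that f q assms by auto
    from coproduct_desc[OF c z this] obtain h where
      "h \<in> Hom C c z" "\<And>j. j \<in> q ` I \<Longrightarrow> h \<cdot> \<kappa> j = f (inv_into I q j)" by blast
    then show "\<exists>h\<in>Hom C c z. \<forall>i\<in>I. h \<cdot> \<iota> i = f i" using assms by force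
  qed
next
  assume c: "is_coproduct C I X c \<iota>"
  show "is_coproduct C (q ` I) Y c \<kappa>"
  proof (rule coproductI)
    show "c \<in> Ob C" using coproduct_Ob[OF c] .
    show "\<kappa> i \<in> Hom C (Y i) c" if "i \<in> q ` I" for i
      using coproduct_inj[OF c] assms that by auto
    show "h = h'" if "h \<in> Hom C c z" "h' \<in> Hom C c z" "\<And>j. j \<in> q ` I \<Longrightarrow> h \<cdot> \<kappa> j = h' \<cdot> \<kappa> j" for z h h'
    proof (rule coproduct_eqI[OF c that(1,2)])
      show "h \<cdot> \<iota> i = h' \<cdot> \<iota> i" if "i \<in> I" for i
        using \<open>\<And>j. j \<in> q ` I \<Longrightarrow> h \<cdot> \<kappa> j = h' \<cdot> \<kappa> j\<close>[of "q i"] assms that by simp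
    qed
    fix z f assume z: "z \<in> Ob C" and f: "\<And>i. i \<in> q ` I \<Longrightarrow> f i \<in> Hom C (Y i) z"
    have "f (q i) \<in> Hom C (X i) z" if "i \<in> I" for i
      using that f[of "q i"] assms by auto
    from coproduct_desc[OF c z this] obtain h where
      "h \<in> Hom C c z" "\<And>i. i \<in> I \<Longrightarrow> h \<cdot> \<iota> i = f (q i)" by blast
    then show "\<exists>h\<in>Hom C c z. \<forall>i\<in>q ` I. h \<cdot> \<kappa> i = f i" using assms by force
  qed
qed

lemma coproduct_cong:
  assumes "\<And>i. i \<in> I \<Longrightarrow> Y i = X i" "\<And>i. i \<in> I \<Longrightarrow> \<kappa> i = \<iota> i"
  shows "is_coproduct C I Y c \<kappa> \<longleftrightarrow> is_coproduct C I X c \<iota>"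
  using coproduct_reindex[of "\<lambda>i. i" I Y X \<kappa> \<iota>] assms by simp

text \<open>The summand \<open>b\<close>, sitting at index \<open>p\<close>, is split into its own summands, indexed by \<open>K\<close>:
  a cocone on the nested family is the same as a cocone on the merged family, because its
  component at \<open>b\<close> amounts to a cocone on \<open>K\<close>.  The remaining summands are named by \<open>J\<close> on the
  flat side and by \<open>q ` J\<close> on the nested side, as the two index types may differ.\<close>

lemma nested_coproduct_iff:
  assumes K: "is_coproduct C K X b \<kappa>" and m: "m \<in> Hom C b c"
    and disj: "J \<inter> K = {}" and \<iota>: "\<And>k. k \<in> K \<Longrightarrow> \<iota> k = m \<cdot> \<kappa> k"
    and q: "inj_on q J" "p \<notin> q ` J"
    and Y: "Y p = b" "\<And>j. j \<in> J \<Longrightarrow> Y (q j) = X j"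
    and \<mu>: "\<mu> p = m" "\<And>j. j \<in> J \<Longrightarrow> \<mu> (q j) = \<iota> j"
  shows "is_coproduct C (insert p (q ` J)) Y c \<mu> \<longleftrightarrow> is_coproduct C (J \<union> K) X c \<iota>"
proof
  have assoc: "h \<cdot> \<iota> k = (h \<cdot> m) \<cdot> \<kappa> k" if "k \<in> K" "h \<in> Hom C c z" for h k z
    using Comp_assoc[OF coproduct_inj[OF K that(1)] m that(2)] \<iota>[OF that(1)] by simp
  {
    assume c: "is_coproduct C (insert p (q ` J)) Y c \<mu>"
    have inj_J: "\<iota> j \<in> Hom C (X j) c" if "j \<in> J" for j
      using coproduct_inj[OF c, of "q j"] Y \<mu> that by auto
    show "is_coproduct C (J \<union> K) X c \<iota>"
    proof (rule coproductI)
      show "c \<in> Ob C" using coproduct_Ob[OF c] .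
      show "\<iota> i \<in> Hom C (X i) c" if "i \<in> J \<union> K" for i
        using that inj_J \<iota> Comp_in_Hom[OF coproduct_inj[OF K] m] by auto
      show "h = h'" if h: "h \<in> Hom C c z" "h' \<in> Hom C c z"
        and eq: "\<And>i. i \<in> J \<union> K \<Longrightarrow> h \<cdot> \<iota> i = h' \<cdot> \<iota> i" for z h h'
      proof (rule coproduct_eqI[OF c h])
        fix i assume "i \<in> insert p (q ` J)"
        moreover have "h \<cdot> m = h' \<cdot> m"
        proof (rule coproduct_eqI[OF K Comp_in_Hom[OF m h(1)] Comp_in_Hom[OF m h(2)]])
          show "(h \<cdot> m) \<cdot> \<kappa> k = (h' \<cdot> m) \<cdot> \<kappa> k" if "k \<in> K" for k
            using assoc[OF that h(1)] assoc[OF that h(2)] eq[of k] that by simp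
        qed
        ultimately show "h \<cdot> \<mu> i = h' \<cdot> \<mu> i" using eq \<mu> by auto
      qed
      fix z f assume z: "z \<in> Ob C" and f: "\<And>i. i \<in> J \<union> K \<Longrightarrow> f i \<in> Hom C (X i) z"
      obtain u where u: "u \<in> Hom C b z" "\<And>k. k \<in> K \<Longrightarrow> u \<cdot> \<kappa> k = f k"
        using coproduct_desc[OF K z, of f] f by blast
      define g where "g y = (if y = p then u else f (inv_into J q y))" for y
      have g: "g p = u" "\<And>j. j \<in> J \<Longrightarrow> g (q j) = f j"
        using q by (auto simp: g_def)
      have "g y \<in> Hom C (Y y) z" if "y \<in> insert p (q ` J)" for y
        using that g u f Y by auto
      from coproduct_desc[OF c z this] obtain h where
        h: "h \<in> Hom C c z" "\<And>y. y \<in> insert p (q ` J) \<Longrightarrow> h \<cdot> \<mu> y = g y" by blast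
      have "h \<cdot> \<iota> i = f i" if "i \<in> J \<union> K" for i
      proof (cases "i \<in> K")
        case True
        then show ?thesis using assoc[OF True h(1)] h(2)[of p] u g \<mu> by simp
      next
        case False
        then show ?thesis using that h(2)[of "q i"] g \<mu> by simp
      qed
      then show "\<exists>h\<in>Hom C c z. \<forall>i\<in>J \<union> K. h \<cdot> \<iota> i = f i" using h by blast
    qed
  }
  {
    assume c: "is_coproduct C (J \<union> K) X c \<iota>"
    show "is_coproduct C (insert p (q ` J)) Y c \<mu>"
    proof (rule coproductI)
      show "c \<in> Ob C" using coproduct_Ob[OF c] .
      show "\<mu> i \<in> Hom C (Y i) c" if "i \<in> insert p (q ` J)" for i
        using that coproduct_inj[OF c] Y \<mu> m by auto
      show "h = h'" if h: "h \<in> Hom C c z" "h' \<in> Hom C c z"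
        and eq: "\<And>i. i \<in> insert p (q ` J) \<Longrightarrow> h \<cdot> \<mu> i = h' \<cdot> \<mu> i" for z h h'
      proof (rule coproduct_eqI[OF c h])
        fix i assume i: "i \<in> J \<union> K"
        show "h \<cdot> \<iota> i = h' \<cdot> \<iota> i"
        proof (cases "i \<in> K")
          case True
          then show ?thesis using assoc[OF True h(1)] assoc[OF True h(2)] eq[of p] \<mu>(1) by simp
        next
          case False
          then show ?thesis using eq[of "q i"] \<mu>(2)[of i] i by simp
        qed
      qed
      fix z f assume z: "z \<in> Ob C" and f: "\<And>i. i \<in> insert p (q ` J) \<Longrightarrow> f i \<in> Hom C (Y i) z"
      define g where "g i = (if i \<in> K then f p \<cdot> \<kappa> i else f (q i))" for i
      have fp: "f p \<in> Hom C b z" using f[of p] Y by simp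
      have "g i \<in> Hom C (X i) z" if "i \<in> J \<union> K" for i
      proof (cases "i \<in> K")
        case True
        then show ?thesis using Comp_in_Hom[OF coproduct_inj[OF K True] fp] by (simp add: g_def)
      next
        case False
        then show ?thesis using that f[of "q i"] Y(2)[of i] by (simp add: g_def)
      qed
      from coproduct_desc[OF c z this] obtain h where
        h: "h \<in> Hom C c z" "\<And>i. i \<in> J \<union> K \<Longrightarrow> h \<cdot> \<iota> i = g i" by blast
      have "h \<cdot> m = f p"
      proof (rule coproduct_eqI[OF K Comp_in_Hom[OF m h(1)] fp])
        show "(h \<cdot> m) \<cdot> \<kappa> k = f p \<cdot> \<kappa> k" if "k \<in> K" for k
          using assoc[OF that h(1)] h(2)[of k] that by (simp add: g_def)
      qed
      moreover have "h \<cdot> \<mu> (q j) = f (q j)" if "j \<in> J" for j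
      proof -
        have "j \<notin> K" using that disj by blast
        then show ?thesis using h(2)[of j] that \<mu>(2)[of j] by (simp add: g_def)
      qed
      ultimately have "\<forall>y\<in>insert p (q ` J). h \<cdot> \<mu> y = f y" using \<mu>(1) by blast
      then show "\<exists>h\<in>Hom C c z. \<forall>y\<in>insert p (q ` J). h \<cdot> \<mu> y = f y" using h by blast
    qed
  }
qed

text \<open>The empty family must be excluded: it would require an initial object.\<close>

lemma finite_coproduct_exists:
  assumes bin: "has_binary_coproducts C"
    and "finite I" "I \<noteq> {}" "\<And>i. i \<in> I \<Longrightarrow> X i \<in> Ob C"
  shows "\<exists>c \<iota>. is_coproduct C I X c \<iota>"
  using assms(2-4)
proof (induction rule: finite_ne_induct)
  case (singleton i)
  then have ob: "X i \<in> Ob C" by simp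
  note id = Ident_in_Hom[OF ob]
  have "is_coproduct C {i} X (X i) (\<lambda>_. Ident C (X i))"
  proof (rule coproductI)
    show "X i \<in> Ob C" by fact
    show "Ident C (X i) \<in> Hom C (X j) (X i)" if "j \<in> {i}" for j
      using that id by simp
    show "\<exists>h\<in>Hom C (X i) z. \<forall>j\<in>{i}. h \<cdot> Ident C (X i) = f j"
      if "\<And>j. j \<in> {i} \<Longrightarrow> f j \<in> Hom C (X j) z" for f z
    proof (rule bexI)
      show f: "f i \<in> Hom C (X i) z" using that[of i] by simp
      show "\<forall>j\<in>{i}. f i \<cdot> Ident C (X i) = f j" using Comp_Ident[OF f] by simp
    qed
    show "h = h'" if "h \<in> Hom C (X i) z" "h' \<in> Hom C (X i) z"
      "\<And>j. j \<in> {i} \<Longrightarrow> h \<cdot> Ident C (X i) = h' \<cdot> Ident C (X i)" for z h h'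
      using that(3)[OF singletonI] unfolding Comp_Ident[OF that(1)] Comp_Ident[OF that(2)] .
  qed
  then show ?case by blast
next
  case (insert i I)
  then obtain b \<kappa> where b: "is_coproduct C I X b \<kappa>" by blast
  have "X i \<in> Ob C" using insert.prems by simp
  from bin[unfolded has_binary_coproducts_def, THEN bspec, OF this, THEN bspec, OF coproduct_Ob[OF b]]
  obtain c \<mu> where c: "is_coproduct C (UNIV :: bool set) (\<lambda>s. if s then X i else b) c \<mu>"
    by (elim exE)
  have m: "\<mu> False \<in> Hom C b c" using coproduct_inj[OF c, of False] by simp
  have "is_coproduct C ({i} \<union> I) X c (\<lambda>j. if j \<in> I then \<mu> False \<cdot> \<kappa> j else \<mu> True)"
  proof (rule nested_coproduct_iff[OF b m, where q="\<lambda>_. True" and p=False and \<mu>=\<mu>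
        and Y="\<lambda>s. if s then X i else b", THEN iffD1])
    have "insert False ((\<lambda>_. True) ` {i}) = (UNIV :: bool set)" by auto
    then show "is_coproduct C (insert False ((\<lambda>_. True) ` {i})) (\<lambda>s. if s then X i else b) c \<mu>"
      using c by simp
  qed (use insert.hyps in auto)
  then show ?case by auto
qed

end

section \<open>Diagrams and their morphisms\<close>

lemma diagram_vert_Ob:
  assumes "is_diagram C G D" "v \<in> verts G"
  shows "D_vert D v \<in> Ob C"
proof -
  have "D_vert D \<in> verts G \<rightarrow>\<^sub>E Ob C" using assms(1) by (simp add: is_diagram_def)
  from PiE_mem[OF this assms(2)] show ?thesis .
qed

lemma diagram_arc_Hom:
  assumes "is_diagram C G D" "e \<in> arcs G"
  shows "D_arc D e \<in> Hom C (D_vert D (tail G e)) (D_vert D (head G e))"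
proof -
  have "D_arc D \<in> (\<Pi>\<^sub>E e\<in>arcs G. Hom C (D_vert D (tail G e)) (D_vert D (head G e)))"
    using assms(1) by (simp add: is_diagram_def)
  from PiE_mem[OF this assms(2)] show ?thesis .
qed

lemma diagram_morphism_Hom:
  assumes "is_diagram_morphism C G D E T" "v \<in> verts G"
  shows "T v \<in> Hom C (D_vert D v) (D_vert E v)"
proof -
  have "T \<in> (\<Pi>\<^sub>E v\<in>verts G. Hom C (D_vert D v) (D_vert E v))"
    using assms(1) by (simp add: is_diagram_morphism_def)
  from PiE_mem[OF this assms(2)] show ?thesis .
qed

lemma diagram_morphism_natural:
  assumes "is_diagram_morphism C G D E T" "e \<in> arcs G"
  shows "Comp C (T (head G e)) (D_arc D e) = Comp C (D_arc E e) (T (tail G e))"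
proof -
  have "\<forall>e\<in>arcs G. Comp C (T (head G e)) (D_arc D e) = Comp C (D_arc E e) (T (tail G e))"
    using assms(1) by (simp add: is_diagram_morphism_def)
  from bspec[OF this assms(2)] show ?thesis .
qed

lemma diagram_morphism_extensional:
  assumes "is_diagram_morphism C G D E T"
  shows "T \<in> extensional (verts G)"
  using assms by (simp add: is_diagram_morphism_def PiE_def)

lemma Ob_Diag_coprod:
  "D \<in> Ob (Diag_coprod C G) \<longleftrightarrow> is_diagram C G D \<and> coproduct_condition C G D"
  by (simp add: Diag_coprod_def)

lemma Hom_Diag_coprod:
  "f \<in> Hom (Diag_coprod C G) D E \<longleftrightarrow>
    D \<in> Ob (Diag_coprod C G) \<and> E \<in> Ob (Diag_coprod C G) \<and>
    (\<exists>T. f = (D, T, E) \<and> is_diagram_morphism C G D E T)"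
  by (cases f) (auto simp: Diag_coprod_def Hom_def Let_def)

lemma Ident_Diag_coprod:
  "Ident (Diag_coprod C G) D = (D, (\<lambda>v\<in>verts G. Ident C (D_vert D v)), D)"
  by (simp add: Diag_coprod_def Let_def)

lemma Comp_Diag_coprod:
  "Comp (Diag_coprod C G) (D', S, E) (D, T, D'') = (D, (\<lambda>v\<in>verts G. Comp C (S v) (T v)), E)"
  by (simp add: Diag_coprod_def Let_def)

section \<open>Coproducts along the delay paths\<close>

text \<open>What is kept of the supremum condition on \<open>d\<close>: the delay of a vertex bounds the delays of
  its incoming arcs and, unless the vertex is a source, is one of them.\<close>

locale category_delay = category C + wf_digraph G
  for C :: "('o, 'm) precategory" (structure) and G :: "('v, 'e) pre_digraph" +
  fixes d :: "'v + 'e \<Rightarrow> nat"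
  assumes arc_delay_le: "e \<in> arcs G \<Longrightarrow> d (Inr e) \<le> d (Inl (head G e))"
    and delay_attained: "v \<in> verts G \<Longrightarrow> in_arcs G v \<noteq> {} \<Longrightarrow>
      \<exists>e\<in>in_arcs G v. d (Inr e) = d (Inl v)"
    and source_delay: "v \<in> verts G \<Longrightarrow> in_arcs G v = {} \<Longrightarrow> d (Inl v) = 0"
begin

abbreviation H :: "('v \<times> nat, 'e + 'v \<times> nat) pre_digraph" where
  "H \<equiv> in_delay G d"

lemma wf_digraph_H: "wf_digraph H"
  using arc_delay_le by (rule wf_digraph_in_delay)

lemma H_simps [simp]:
  "(v, n) \<in> verts H \<longleftrightarrow> v \<in> verts G \<and> n \<le> d (Inl v)"
  "Inl e \<in> arcs H \<longleftrightarrow> e \<in> arcs G"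
  "Inr (v, n) \<in> arcs H \<longleftrightarrow> v \<in> verts G \<and> 1 \<le> n \<and> n \<le> d (Inl v)"
  "tail H (Inl e) = (tail G e, 0)" "tail H (Inr (v, n)) = (v, n)"
  "head H (Inl e) = (head G e, d (Inr e))" "head H (Inr (v, n)) = (v, n - 1)"
  by (auto simp: in_delay_def)

lemma in_arcs_H:
  assumes "v \<in> verts G"
  shows "in_arcs H (v, n) = Inl ` {e \<in> in_arcs G v. d (Inr e) = n} \<union>
    (if n < d (Inl v) then {Inr (v, Suc n)} else {})"
  using assms by (auto simp: in_delay_def in_arcs_def image_iff)

lemma H_arc_Inl_Hom:
  assumes "is_diagram C H E" "e \<in> arcs G"
  shows "D_arc E (Inl e) \<in> Hom C (D_vert E (tail G e, 0)) (D_vert E (head G e, d (Inr e)))"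
  using diagram_arc_Hom[OF assms(1), of "Inl e"] assms(2) by simp

lemma H_arc_Inr_Hom:
  assumes "is_diagram C H E" "v \<in> verts G" "n < d (Inl v)"
  shows "D_arc E (Inr (v, Suc n)) \<in> Hom C (D_vert E (v, Suc n)) (D_vert E (v, n))"
  using diagram_arc_Hom[OF assms(1), of "Inr (v, Suc n)"] assms(2,3) by simp

text \<open>The composite along \<open>e\<close> and the path from \<open>(head G e, d (Inr e))\<close> down to
  \<open>(head G e, n)\<close>.  It is meaningful for \<open>n \<le> d (Inr e)\<close>; the recursion goes up the path, so
  that each unfolding splits off the last arc of the composite.\<close>

function leg :: "('v \<times> nat, 'e + 'v \<times> nat, 'o, 'm) diagram \<Rightarrow> 'e \<Rightarrow> nat \<Rightarrow> 'm" where
  "leg E e n = (if n < d (Inr e) then D_arc E (Inr (head G e, Suc n)) \<cdot> leg E e (Suc n)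
    else D_arc E (Inl e))"
  by auto
termination by (relation "measure (\<lambda>(E, e, n). d (Inr e) - n)") auto

declare leg.simps [simp del]

lemma leg_top: "leg E e (d (Inr e)) = D_arc E (Inl e)"
  by (simp add: leg.simps)

lemma leg_step: "n < d (Inr e) \<Longrightarrow> leg E e n = D_arc E (Inr (head G e, Suc n)) \<cdot> leg E e (Suc n)"
  by (simp add: leg.simps[of E e n])

lemma leg_Hom:
  assumes E: "is_diagram C H E" and e: "e \<in> arcs G" and n: "n \<le> d (Inr e)"
  shows "leg E e n \<in> Hom C (D_vert E (tail G e, 0)) (D_vert E (head G e, n))"
  using n
proof (induction rule: inc_induct)
  case base
  show ?case using H_arc_Inl_Hom[OF E e] by (simp only: leg_top)
next
  case (step n)
  have "n < d (Inl (head G e))" using step.hyps arc_delay_le[OF e] by simp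
  from Comp_in_Hom[OF step.IH H_arc_Inr_Hom[OF E head_in_verts[OF e] this]]
  show ?case by (simp only: leg_step[OF step.hyps(2)])
qed

lemma leg_natural:
  assumes E: "is_diagram C H E" and E': "is_diagram C H E'"
    and T: "is_diagram_morphism C H E E' T" and e: "e \<in> arcs G" and n: "n \<le> d (Inr e)"
  shows "T (head G e, n) \<cdot> leg E e n = leg E' e n \<cdot> T (tail G e, 0)"
  using n
proof (induction rule: inc_induct)
  case base
  show ?case using diagram_morphism_natural[OF T, of "Inl e"] e by (simp add: leg_top)
next
  case (step n)
  let ?v = "head G e"
  have v: "?v \<in> verts G" and n: "n < d (Inl ?v)"
    using step.hyps arc_delay_le[OF e] head_in_verts[OF e] by simp_all
  note T_Hom = diagram_morphism_Hom[OF T]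
  have t: "T (tail G e, 0) \<in> Hom C (D_vert E (tail G e, 0)) (D_vert E' (tail G e, 0))"
    using T_Hom tail_in_verts[OF e] by simp
  have nat: "T (?v, n) \<cdot> D_arc E (Inr (?v, Suc n)) = D_arc E' (Inr (?v, Suc n)) \<cdot> T (?v, Suc n)"
    using diagram_morphism_natural[OF T, of "Inr (?v, Suc n)"] v n by simp
  note l = leg_Hom[OF E e] leg_Hom[OF E' e]
  have "T (?v, n) \<cdot> leg E e n = (T (?v, n) \<cdot> D_arc E (Inr (?v, Suc n))) \<cdot> leg E e (Suc n)"
    unfolding leg_step[OF step.hyps(2)]
    by (rule Comp_assoc[symmetric, OF l(1) H_arc_Inr_Hom[OF E v n] T_Hom]) (use v n step.hyps in auto)
  also have "\<dots> = D_arc E' (Inr (?v, Suc n)) \<cdot> (T (?v, Suc n) \<cdot> leg E e (Suc n))"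
    unfolding nat
    by (rule Comp_assoc[OF l(1) T_Hom H_arc_Inr_Hom[OF E' v n]]) (use v n step.hyps in auto)
  also have "\<dots> = D_arc E' (Inr (?v, Suc n)) \<cdot> (leg E' e (Suc n) \<cdot> T (tail G e, 0))"
    unfolding step.IH ..
  also have "\<dots> = leg E' e n \<cdot> T (tail G e, 0)"
    unfolding leg_step[OF step.hyps(2)]
    by (rule Comp_assoc[symmetric, OF t l(2) H_arc_Inr_Hom[OF E' v n]]) (use step.hyps in auto)
  finally show ?case .
qed

definition level_coproduct ::
    "('v \<times> nat, 'e + 'v \<times> nat, 'o, 'm) diagram \<Rightarrow> 'v \<Rightarrow> nat \<Rightarrow> bool" where
  "level_coproduct E v n \<longleftrightarrow>
     is_coproduct C {e \<in> in_arcs G v. n \<le> d (Inr e)} (\<lambda>e. D_vert E (tail G e, 0))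
       (D_vert E (v, n)) (\<lambda>e. leg E e n)"

text \<open>No path arc enters the top of a path, and an arc of delay at least the maximum has
  exactly that delay; hence the two families agree up to renaming the arcs.\<close>

lemma top_coproduct_iff:
  assumes v: "v \<in> verts G"
  shows "is_coproduct C (in_arcs H (v, d (Inl v))) (\<lambda>a. D_vert E (tail H a))
      (D_vert E (v, d (Inl v))) (D_arc E) \<longleftrightarrow> level_coproduct E v (d (Inl v))"
proof -
  have top: "d (Inl v) \<le> d (Inr e) \<longleftrightarrow> d (Inr e) = d (Inl v)" if "e \<in> in_arcs G v" for e
    using arc_delay_le[of e] that by (auto simp: in_arcs_def)
  then have arcs: "in_arcs H (v, d (Inl v)) = Inl ` {e \<in> in_arcs G v. d (Inl v) \<le> d (Inr e)}"
    by (auto simp: in_arcs_H[OF v])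
  show ?thesis
    unfolding level_coproduct_def arcs
  proof (rule coproduct_reindex)
    show "D_arc E (Inl e) = leg E e (d (Inl v))"
      if "e \<in> {e \<in> in_arcs G v. d (Inl v) \<le> d (Inr e)}" for e
      using top[of e] that leg_top[of E e] by simp
  qed auto
qed

text \<open>The path arc from level \<open>Suc n\<close> brings in the coproduct over the arcs of delay at least
  \<open>Suc n\<close>, and the other incoming arcs are those of delay \<open>n\<close>; splitting the former gives the
  arcs of delay at least \<open>n\<close>.\<close>

lemma lower_coproduct_iff:
  assumes E: "is_diagram C H E" and v: "v \<in> verts G" and n: "n < d (Inl v)"
    and K: "level_coproduct E v (Suc n)"
  shows "is_coproduct C (in_arcs H (v, n)) (\<lambda>a. D_vert E (tail H a)) (D_vert E (v, n)) (D_arc E)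
    \<longleftrightarrow> level_coproduct E v n"
proof -
  let ?J = "{e \<in> in_arcs G v. d (Inr e) = n}" and ?K = "{e \<in> in_arcs G v. Suc n \<le> d (Inr e)}"
  have "is_coproduct C (insert (Inr (v, Suc n)) (Inl ` ?J)) (\<lambda>a. D_vert E (tail H a))
      (D_vert E (v, n)) (D_arc E) \<longleftrightarrow>
    is_coproduct C (?J \<union> ?K) (\<lambda>e. D_vert E (tail G e, 0)) (D_vert E (v, n)) (\<lambda>e. leg E e n)"
    by (rule nested_coproduct_iff[OF K[unfolded level_coproduct_def] H_arc_Inr_Hom[OF E v n]])
      (auto simp: leg_step leg_top)
  moreover have "in_arcs H (v, n) = insert (Inr (v, Suc n)) (Inl ` ?J)"
    using n by (simp add: in_arcs_H[OF v])
  moreover have "?J \<union> ?K = {e \<in> in_arcs G v. n \<le> d (Inr e)}" by auto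
  ultimately show ?thesis unfolding level_coproduct_def by simp
qed

text \<open>The vertices for which the coproduct condition is vacuous correspond: below the top of a
  path there is a path arc to come from, and the top receives an arc of maximal delay.\<close>

lemma in_arcs_H_empty_iff:
  assumes v: "v \<in> verts G" and n: "n \<le> d (Inl v)"
  shows "in_arcs H (v, n) = {} \<longleftrightarrow> in_arcs G v = {}"
proof
  assume empty: "in_arcs H (v, n) = {}"
  then have "n = d (Inl v)" using n by (auto simp: in_arcs_H[OF v] split: if_splits)
  then show "in_arcs G v = {}" using empty delay_attained[OF v] by (auto simp: in_arcs_H[OF v])
next
  assume "in_arcs G v = {}"
  then show "in_arcs H (v, n) = {}" using source_delay[OF v] by (simp add: in_arcs_H[OF v])
qed

text \<open>The local condition at the vertices of the in-delay, which mixes arcs of \<open>G\<close> with path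
  arcs, is traded for conditions that involve only arcs of \<open>G\<close>.  From left to right, this is an
  induction down each path.\<close>

lemma coproduct_condition_H_iff:
  assumes E: "is_diagram C H E"
  shows "coproduct_condition C H E \<longleftrightarrow>
    (\<forall>v\<in>verts G. in_arcs G v \<noteq> {} \<longrightarrow> (\<forall>n\<le>d (Inl v). level_coproduct E v n))"
proof
  assume cop: "coproduct_condition C H E"
  show "\<forall>v\<in>verts G. in_arcs G v \<noteq> {} \<longrightarrow> (\<forall>n\<le>d (Inl v). level_coproduct E v n)"
  proof (intro ballI impI allI)
    fix v n assume v: "v \<in> verts G" and ns: "in_arcs G v \<noteq> {}" and n: "n \<le> d (Inl v)"
    have at: "is_coproduct C (in_arcs H (v, k)) (\<lambda>a. D_vert E (tail H a)) (D_vert E (v, k)) (D_arc E)"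
      if "k \<le> d (Inl v)" for k
      using cop[unfolded coproduct_condition_def, THEN bspec, of "(v, k)"] v ns that
      by (simp add: in_arcs_H_empty_iff)
    from n show "level_coproduct E v n"
    proof (induction rule: inc_induct)
      case base
      show ?case using at[of "d (Inl v)"] top_coproduct_iff[OF v] by simp
    next
      case (step n)
      show ?case
        using at[of n] step.hyps lower_coproduct_iff[OF E v step.hyps(2) step.IH] by simp
    qed
  qed
next
  assume level: "\<forall>v\<in>verts G. in_arcs G v \<noteq> {} \<longrightarrow> (\<forall>n\<le>d (Inl v). level_coproduct E v n)"
  show "coproduct_condition C H E"
    unfolding coproduct_condition_def
  proof (intro ballI impI)
    fix x assume "x \<in> verts H" and ne: "in_arcs H x \<noteq> {}"
    then obtain v n where x: "x = (v, n)" and v: "v \<in> verts G" and n: "n \<le> d (Inl v)"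
      by (cases x) auto
    have l: "level_coproduct E v k" if "k \<le> d (Inl v)" for k
      using level v that in_arcs_H_empty_iff[OF v n] ne x by simp
    show "is_coproduct C (in_arcs H x) (\<lambda>a. D_vert E (tail H a)) (D_vert E x) (D_arc E)"
    proof (cases "n = d (Inl v)")
      case True
      then show ?thesis using top_coproduct_iff[OF v] l[OF n] x by simp
    next
      case False
      then have "n < d (Inl v)" using n by simp
      then show ?thesis using lower_coproduct_iff[OF E v] l[of n] l[of "Suc n"] x by simp
    qed
  qed
qed

section \<open>Collapsing the delay paths\<close>

definition collapse ::
    "('v \<times> nat, 'e + 'v \<times> nat, 'o, 'm) diagram \<Rightarrow> ('v, 'e, 'o, 'm) diagram" where
  "collapse E = \<lparr> D_vert = (\<lambda>v\<in>verts G. D_vert E (v, 0)), D_arc = (\<lambda>e\<in>arcs G. leg E e 0) \<rparr>"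

definition collapse_arr where
  "collapse_arr = (\<lambda>(E, T, E'). (collapse E, (\<lambda>v\<in>verts G. T (v, 0)), collapse E'))"

lemma collapse_simps [simp]:
  "v \<in> verts G \<Longrightarrow> D_vert (collapse E) v = D_vert E (v, 0)"
  "e \<in> arcs G \<Longrightarrow> D_arc (collapse E) e = leg E e 0"
  by (simp_all add: collapse_def)

lemma collapse_Ob:
  assumes "E \<in> Ob (Diag_coprod C H)"
  shows "collapse E \<in> Ob (Diag_coprod C G)"
proof -
  have E: "is_diagram C H E" and cop: "coproduct_condition C H E"
    using assms by (simp_all add: Ob_Diag_coprod)
  have "D_vert E (v, 0) \<in> Ob C" if "v \<in> verts G" for v
    using diagram_vert_Ob[OF E, of "(v, 0)"] that by simp
  moreover have "leg E e 0 \<in> Hom C (D_vert E (tail G e, 0)) (D_vert E (head G e, 0))"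
    if "e \<in> arcs G" for e
    using leg_Hom[OF E that] by simp
  ultimately have "is_diagram C G (collapse E)"
    by (simp add: is_diagram_def collapse_def)
  moreover have "coproduct_condition C G (collapse E)"
    unfolding coproduct_condition_def
  proof (intro ballI impI)
    fix v assume v: "v \<in> verts G" and "in_arcs G v \<noteq> {}"
    then have "level_coproduct E v 0" using cop coproduct_condition_H_iff[OF E] by simp
    then have "is_coproduct C (in_arcs G v) (\<lambda>e. D_vert E (tail G e, 0)) (D_vert E (v, 0)) (\<lambda>e. leg E e 0)"
      by (simp add: level_coproduct_def in_arcs_def)
    moreover have "is_coproduct C (in_arcs G v) (\<lambda>e. D_vert (collapse E) (tail G e))
        (D_vert E (v, 0)) (D_arc (collapse E)) \<longleftrightarrow>
      is_coproduct C (in_arcs G v) (\<lambda>e. D_vert E (tail G e, 0)) (D_vert E (v, 0)) (\<lambda>e. leg E e 0)"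
      by (rule coproduct_cong) (simp_all add: in_arcs_def)
    ultimately show "is_coproduct C (in_arcs G v) (\<lambda>e. D_vert (collapse E) (tail G e))
        (D_vert (collapse E) v) (D_arc (collapse E))"
      using v by simp
  qed
  ultimately show ?thesis by (simp add: Ob_Diag_coprod)
qed

lemma collapse_morphism:
  assumes E: "is_diagram C H E" and E': "is_diagram C H E'"
    and T: "is_diagram_morphism C H E E' T"
  shows "is_diagram_morphism C G (collapse E) (collapse E') (\<lambda>v\<in>verts G. T (v, 0))"
proof -
  have "T (v, 0) \<in> Hom C (D_vert E (v, 0)) (D_vert E' (v, 0))" if "v \<in> verts G" for v
    using diagram_morphism_Hom[OF T, of "(v, 0)"] that by simp
  moreover have "T (head G e, 0) \<cdot> leg E e 0 = leg E' e 0 \<cdot> T (tail G e, 0)" if "e \<in> arcs G" for e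
    using leg_natural[OF E E' T that] by simp
  ultimately show ?thesis by (simp add: is_diagram_morphism_def)
qed

lemma collapse_functor:
  "cat_functor (Diag_coprod C H) (Diag_coprod C G) collapse collapse_arr"
proof -
  interpret DH: category "Diag_coprod C H" by (rule category_Diag_coprod[OF wf_digraph_H])
  interpret DG: category "Diag_coprod C G" by (rule category_Diag_coprod[OF wf_digraph_axioms])
  show ?thesis
  proof unfold_locales
    show "collapse E \<in> Ob (Diag_coprod C G)" if "E \<in> Ob (Diag_coprod C H)" for E
      using that by (rule collapse_Ob)
    show "collapse_arr f \<in> Hom (Diag_coprod C G) (collapse E) (collapse E')"
      if "f \<in> Hom (Diag_coprod C H) E E'" for f E E'
      using that collapse_Ob collapse_morphism
      by (auto simp: Hom_Diag_coprod collapse_arr_def Ob_Diag_coprod)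
    show "collapse_arr (Ident (Diag_coprod C H) E) = Ident (Diag_coprod C G) (collapse E)" for E
      by (simp add: Ident_Diag_coprod collapse_arr_def cong: restrict_cong)
    show "collapse_arr (Comp (Diag_coprod C H) g f) =
        Comp (Diag_coprod C G) (collapse_arr g) (collapse_arr f)"
      if "f \<in> Hom (Diag_coprod C H) E E'" "g \<in> Hom (Diag_coprod C H) E' E''" for f g E E' E''
      using that by (auto simp: Hom_Diag_coprod Comp_Diag_coprod collapse_arr_def cong: restrict_cong)
  qed
qed

text \<open>Naturality determines \<open>S (v, n) \<cdot> leg E e n\<close> from the value of \<open>S\<close> at the tail of \<open>e\<close>,
  which lies on level \<open>0\<close>, and the legs at \<open>(v, n)\<close> are jointly epic.  A source has no levels
  other than \<open>0\<close>.\<close>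

lemma delay_morphism_eqI:
  assumes E: "E \<in> Ob (Diag_coprod C H)" and E': "is_diagram C H E'"
    and S: "is_diagram_morphism C H E E' S" and T: "is_diagram_morphism C H E E' T"
    and eq: "\<And>v. v \<in> verts G \<Longrightarrow> S (v, 0) = T (v, 0)"
  shows "S = T"
proof (rule extensionalityI[OF diagram_morphism_extensional[OF S] diagram_morphism_extensional[OF T]])
  have diag: "is_diagram C H E" and cop: "coproduct_condition C H E"
    using E by (simp_all add: Ob_Diag_coprod)
  fix x assume x: "x \<in> verts H"
  then obtain v n where x_eq: "x = (v, n)" and v: "v \<in> verts G" and n: "n \<le> d (Inl v)"
    by (cases x) auto
  show "S x = T x"
  proof (cases "in_arcs G v = {}")
    case True
    then show ?thesis using source_delay[OF v] n eq[OF v] x_eq by simp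
  next
    case False
    then have "level_coproduct E v n"
      using cop coproduct_condition_H_iff[OF diag] v n by simp
    then show ?thesis
      unfolding level_coproduct_def x_eq
    proof (rule coproduct_eqI)
      show "S (v, n) \<in> Hom C (D_vert E (v, n)) (D_vert E' (v, n))"
        "T (v, n) \<in> Hom C (D_vert E (v, n)) (D_vert E' (v, n))"
        using diagram_morphism_Hom[OF S x] diagram_morphism_Hom[OF T x] x_eq by simp_all
      fix e assume "e \<in> {e \<in> in_arcs G v. n \<le> d (Inr e)}"
      then have e: "e \<in> arcs G" "head G e = v" "n \<le> d (Inr e)" by (simp_all add: in_arcs_def)
      show "S (v, n) \<cdot> leg E e n = T (v, n) \<cdot> leg E e n"
        using leg_natural[OF diag E' S e(1,3)] leg_natural[OF diag E' T e(1,3)]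
          eq[OF tail_in_verts[OF e(1)]] e(2)
        by simp
    qed
  qed
qed

text \<open>The universal property of the coproduct on level \<open>n\<close> yields \<open>T (v, n)\<close> as the morphism
  compatible with \<open>S\<close> along all legs.  On level \<open>0\<close> the given \<open>S v\<close> is such a morphism because
  \<open>S\<close> is natural with respect to the collapsed diagrams.\<close>

lemma delay_morphism_exists:
  assumes E: "E \<in> Ob (Diag_coprod C H)" and E': "is_diagram C H E'"
    and S: "is_diagram_morphism C G (collapse E) (collapse E') S"
  shows "\<exists>T. is_diagram_morphism C H E E' T \<and> (\<forall>v\<in>verts G. T (v, 0) = S v)"
proof -
  have diag: "is_diagram C H E" and cop: "coproduct_condition C H E"
    using E by (simp_all add: Ob_Diag_coprod)
  have S_Hom: "S v \<in> Hom C (D_vert E (v, 0)) (D_vert E' (v, 0))" if "v \<in> verts G" for v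
    using diagram_morphism_Hom[OF S that] that by simp
  have level: "level_coproduct E v n" if "v \<in> verts G" "in_arcs G v \<noteq> {}" "n \<le> d (Inl v)" for v n
    using that cop coproduct_condition_H_iff[OF diag] by simp
  have rhs: "leg E' e n \<cdot> S (tail G e) \<in> Hom C (D_vert E (tail G e, 0)) (D_vert E' (head G e, n))"
    if "e \<in> arcs G" "n \<le> d (Inr e)" for e n
    using Comp_in_Hom[OF S_Hom[OF tail_in_verts[OF that(1)]] leg_Hom[OF E' that]] .
  define P where "P v n h \<longleftrightarrow> h \<in> Hom C (D_vert E (v, n)) (D_vert E' (v, n)) \<and>
    (\<forall>e\<in>in_arcs G v. n \<le> d (Inr e) \<longrightarrow> h \<cdot> leg E e n = leg E' e n \<cdot> S (tail G e)) \<and>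
    (n = 0 \<longrightarrow> h = S v)" for v n h
  have "\<exists>h. P v n h" if v: "v \<in> verts G" and n: "n \<le> d (Inl v)" for v n
  proof (cases "n = 0")
    case True
    have "S v \<cdot> leg E e 0 = leg E' e 0 \<cdot> S (tail G e)" if "e \<in> in_arcs G v" for e
      using diagram_morphism_natural[OF S, of e] that by (simp add: in_arcs_def)
    then have "P v n (S v)" using S_Hom[OF v] True by (simp add: P_def)
    then show ?thesis ..
  next
    case False
    then have "in_arcs G v \<noteq> {}" using n source_delay[OF v] by auto
    note l = level[OF v this n, unfolded level_coproduct_def]
    have z: "D_vert E' (v, n) \<in> Ob C" using diagram_vert_Ob[OF E', of "(v, n)"] v n by simp
    obtain h where "h \<in> Hom C (D_vert E (v, n)) (D_vert E' (v, n))"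
      "\<And>e. e \<in> {e \<in> in_arcs G v. n \<le> d (Inr e)} \<Longrightarrow> h \<cdot> leg E e n = leg E' e n \<cdot> S (tail G e)"
      by (rule coproduct_desc[OF l z, of "\<lambda>e. leg E' e n \<cdot> S (tail G e)"])
        (use rhs in \<open>auto simp: in_arcs_def\<close>)
    then have "P v n h" using False by (simp add: P_def)
    then show ?thesis ..
  qed
  then obtain h where h: "P v n (h v n)" if "v \<in> verts G" "n \<le> d (Inl v)" for v n
    by metis
  have h_Hom: "h v n \<in> Hom C (D_vert E (v, n)) (D_vert E' (v, n))"
    if "v \<in> verts G" "n \<le> d (Inl v)" for v n
    using h[OF that] by (simp add: P_def)
  have h_leg: "h (head G e) n \<cdot> leg E e n = leg E' e n \<cdot> S (tail G e)"
    if "e \<in> arcs G" "n \<le> d (Inr e)" for e n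
    using h[of "head G e" n] that arc_delay_le[of e] by (simp add: P_def in_arcs_def)
  have h_0: "h v 0 = S v" if "v \<in> verts G" for v
    using h[OF that, of 0] by (simp add: P_def)
  define T where "T = (\<lambda>x\<in>verts H. h (fst x) (snd x))"
  have T: "T (v, n) = h v n" if "v \<in> verts G" "n \<le> d (Inl v)" for v n
    using that by (simp add: T_def)
  have "T (head H a) \<cdot> D_arc E a = D_arc E' a \<cdot> T (tail H a)" if a: "a \<in> arcs H" for a
  proof (cases a)
    case (Inl e)
    then have e: "e \<in> arcs G" using a by simp
    have "h (head G e) (d (Inr e)) \<cdot> D_arc E (Inl e) = D_arc E' (Inl e) \<cdot> S (tail G e)"
      using h_leg[OF e order_refl] unfolding leg_top .
    then show ?thesis
      using Inl e arc_delay_le[OF e] by (simp add: T h_0)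
  next
    case (Inr y)
    then obtain v n where y: "a = Inr (v, Suc n)" and v: "v \<in> verts G" and n: "n < d (Inl v)"
      using a by (cases y; cases "snd y") auto
    note arc = H_arc_Inr_Hom[OF diag v n] and arc' = H_arc_Inr_Hom[OF E' v n]
    have h_n: "h v n \<in> Hom C (D_vert E (v, n)) (D_vert E' (v, n))"
      and h_Suc: "h v (Suc n) \<in> Hom C (D_vert E (v, Suc n)) (D_vert E' (v, Suc n))"
      using h_Hom v n by simp_all
    have ne: "in_arcs G v \<noteq> {}" using n source_delay[OF v] by auto
    \<comment> \<open>Naturality along a path arc is tested on the legs into its tail, where both sides
      become \<open>leg E' e n \<cdot> S (tail G e)\<close>.\<close>
    have "level_coproduct E v (Suc n)" using level[OF v ne] n by simp
    then have "h v n \<cdot> D_arc E (Inr (v, Suc n)) = D_arc E' (Inr (v, Suc n)) \<cdot> h v (Suc n)"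
      unfolding level_coproduct_def
    proof (rule coproduct_eqI[OF _ Comp_in_Hom[OF arc h_n] Comp_in_Hom[OF h_Suc arc']])
      fix e assume "e \<in> {e \<in> in_arcs G v. Suc n \<le> d (Inr e)}"
      then have e: "e \<in> arcs G" and v_eq: "head G e = v" and lt: "n < d (Inr e)"
        by (simp_all add: in_arcs_def)
      have leg: "leg E e (Suc n) \<in> Hom C (D_vert E (tail G e, 0)) (D_vert E (v, Suc n))"
        and leg': "leg E' e (Suc n) \<in> Hom C (D_vert E' (tail G e, 0)) (D_vert E' (v, Suc n))"
        using leg_Hom[OF diag e, of "Suc n"] leg_Hom[OF E' e, of "Suc n"] lt v_eq by simp_all
      have "(h v n \<cdot> D_arc E (Inr (v, Suc n))) \<cdot> leg E e (Suc n) = h v n \<cdot> leg E e n"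
        using Comp_assoc[OF leg arc h_n] leg_step[OF lt, of E] v_eq by simp
      also have "\<dots> = leg E' e n \<cdot> S (tail G e)"
        using h_leg[OF e, of n] lt v_eq by simp
      also have "\<dots> = D_arc E' (Inr (v, Suc n)) \<cdot> (leg E' e (Suc n) \<cdot> S (tail G e))"
        using Comp_assoc[OF S_Hom[OF tail_in_verts[OF e]] leg' arc'] leg_step[OF lt, of E'] v_eq
        by simp
      also have "leg E' e (Suc n) \<cdot> S (tail G e) = h v (Suc n) \<cdot> leg E e (Suc n)"
        using h_leg[OF e, of "Suc n"] lt v_eq by simp
      also have "D_arc E' (Inr (v, Suc n)) \<cdot> (h v (Suc n) \<cdot> leg E e (Suc n)) =
          (D_arc E' (Inr (v, Suc n)) \<cdot> h v (Suc n)) \<cdot> leg E e (Suc n)"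
        using Comp_assoc[OF leg h_Suc arc'] by simp
      finally show "(h v n \<cdot> D_arc E (Inr (v, Suc n))) \<cdot> leg E e (Suc n) =
          (D_arc E' (Inr (v, Suc n)) \<cdot> h v (Suc n)) \<cdot> leg E e (Suc n)" .
    qed
    then show ?thesis using y v n by (simp add: T)
  qed
  moreover have "T \<in> (\<Pi>\<^sub>E x\<in>verts H. Hom C (D_vert E x) (D_vert E' x))"
    using h_Hom by (auto simp: T_def)
  ultimately have "is_diagram_morphism C H E E' T" by (simp add: is_diagram_morphism_def)
  then show ?thesis using T h_0 by auto
qed

lemma collapse_fully_faithful:
  assumes "E \<in> Ob (Diag_coprod C H)" "E' \<in> Ob (Diag_coprod C H)"
  shows "bij_betw collapse_arr (Hom (Diag_coprod C H) E E')
    (Hom (Diag_coprod C G) (collapse E) (collapse E'))"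
proof -
  interpret K: cat_functor "Diag_coprod C H" "Diag_coprod C G" collapse collapse_arr
    by (rule collapse_functor)
  have E': "is_diagram C H E'" using assms(2) by (simp add: Ob_Diag_coprod)
  show ?thesis
    unfolding bij_betw_def
  proof
    show "inj_on collapse_arr (Hom (Diag_coprod C H) E E')"
    proof (rule inj_onI)
      fix f g
      assume "f \<in> Hom (Diag_coprod C H) E E'" "g \<in> Hom (Diag_coprod C H) E E'"
        and eq: "collapse_arr f = collapse_arr g"
      then obtain S T where f: "f = (E, S, E')" and g: "g = (E, T, E')"
        and S: "is_diagram_morphism C H E E' S" and T: "is_diagram_morphism C H E E' T"
        by (auto simp: Hom_Diag_coprod)
      have res: "(\<lambda>v\<in>verts G. S (v, 0)) = (\<lambda>v\<in>verts G. T (v, 0))"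
        using eq f g by (simp add: collapse_arr_def)
      have "S (v, 0) = T (v, 0)" if "v \<in> verts G" for v
        using fun_cong[OF res, of v] that by simp
      from delay_morphism_eqI[OF assms(1) E' S T this] show "f = g" using f g by simp
    qed
    show "collapse_arr ` Hom (Diag_coprod C H) E E' =
        Hom (Diag_coprod C G) (collapse E) (collapse E')"
    proof (intro equalityI subsetI)
      fix f assume "f \<in> Hom (Diag_coprod C G) (collapse E) (collapse E')"
      then obtain S where f: "f = (collapse E, S, collapse E')"
        and S: "is_diagram_morphism C G (collapse E) (collapse E') S"
        by (auto simp: Hom_Diag_coprod)
      obtain T where T: "is_diagram_morphism C H E E' T" and "\<forall>v\<in>verts G. T (v, 0) = S v"
        using delay_morphism_exists[OF assms(1) E' S] by blast
      then have "(\<lambda>v\<in>verts G. T (v, 0)) = S"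
        by (intro extensionalityI[OF _ diagram_morphism_extensional[OF S]]) auto
      then have "f = collapse_arr (E, T, E')" using f by (simp add: collapse_arr_def)
      moreover have "(E, T, E') \<in> Hom (Diag_coprod C H) E E'"
        using T assms by (simp add: Hom_Diag_coprod)
      ultimately show "f \<in> collapse_arr ` Hom (Diag_coprod C H) E E'" by (rule image_eqI)
    qed (use K.F_Hom in blast)
  qed
qed

text \<open>The objects on positive levels are chosen as coproducts of the families that
  \<open>coproduct_condition_H_iff\<close> prescribes, and the arcs so that the legs of the new diagram are the
  chosen injections.  These families are finite since there are no infinite receivers, and nonempty
  since some arc attains the delay of the vertex.\<close>

lemma collapse_surjective:
  assumes fin: "\<And>v. v \<in> verts G \<Longrightarrow> finite (in_arcs G v)"
    and bin: "has_binary_coproducts C" and D_Ob: "D \<in> Ob (Diag_coprod C G)"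
  shows "\<exists>E\<in>Ob (Diag_coprod C H). collapse E = D"
proof -
  have D: "is_diagram C G D" and cop: "coproduct_condition C G D"
    using D_Ob by (simp_all add: Ob_Diag_coprod)
  \<comment> \<open>\<open>x\<close> and \<open>\<iota>\<close> are the object at \<open>(v, n)\<close> and the legs into it.  Taking \<open>D\<close> itself on level
    \<open>0\<close> makes the collapse of the new diagram equal to \<open>D\<close>, not merely isomorphic.\<close>
  define P where "P v n x \<iota> \<longleftrightarrow> (n = 0 \<longrightarrow> x = D_vert D v \<and> \<iota> = D_arc D) \<and>
    (in_arcs G v \<noteq> {} \<longrightarrow> n \<le> d (Inl v) \<longrightarrow>
      is_coproduct C {e \<in> in_arcs G v. n \<le> d (Inr e)} (\<lambda>e. D_vert D (tail G e)) x \<iota>)" for v n x \<iota>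
  have "\<exists>x \<iota>. P v n x \<iota>" if v: "v \<in> verts G" for v n
  proof (cases "n = 0")
    case True
    then have "P v n (D_vert D v) (D_arc D)"
      using cop v by (simp add: P_def coproduct_condition_def in_arcs_def)
    then show ?thesis by blast
  next
    case False
    show ?thesis
    proof (cases "in_arcs G v \<noteq> {} \<and> n \<le> d (Inl v)")
      case True
      have "\<exists>x \<iota>. is_coproduct C {e \<in> in_arcs G v. n \<le> d (Inr e)} (\<lambda>e. D_vert D (tail G e)) x \<iota>"
      proof (rule finite_coproduct_exists[OF bin])
        show "finite {e \<in> in_arcs G v. n \<le> d (Inr e)}" by (rule finite_subset[OF _ fin[OF v]]) auto
        show "{e \<in> in_arcs G v. n \<le> d (Inr e)} \<noteq> {}" using delay_attained[OF v] True by auto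
        show "D_vert D (tail G e) \<in> Ob C" if "e \<in> {e \<in> in_arcs G v. n \<le> d (Inr e)}" for e
          using diagram_vert_Ob[OF D, of "tail G e"] that by (simp add: in_arcs_def)
      qed
      then show ?thesis using False by (simp add: P_def)
    qed (use False in \<open>auto simp: P_def\<close>)
  qed
  then obtain X \<iota> where P: "P v n (X v n) (\<iota> v n)" if "v \<in> verts G" for v n
    by metis
  have X_0: "X v 0 = D_vert D v" and \<iota>_0: "\<iota> v 0 = D_arc D" if "v \<in> verts G" for v
    using P[OF that, of 0] by (simp_all add: P_def)
  have X: "is_coproduct C {e \<in> in_arcs G v. n \<le> d (Inr e)} (\<lambda>e. D_vert D (tail G e)) (X v n) (\<iota> v n)"
    if "v \<in> verts G" "in_arcs G v \<noteq> {}" "n \<le> d (Inl v)" for v n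
    using P[OF that(1), of n] that by (simp add: P_def)
  have X_Ob: "X v n \<in> Ob C" if "v \<in> verts G" "n \<le> d (Inl v)" for v n
  proof (cases "in_arcs G v = {}")
    case True
    then show ?thesis using source_delay[OF that(1)] that X_0 diagram_vert_Ob[OF D that(1)] by simp
  next
    case False
    then show ?thesis using coproduct_Ob[OF X] that by blast
  qed
  have \<iota>_Hom: "\<iota> (head G e) n e \<in> Hom C (D_vert D (tail G e)) (X (head G e) n)"
    if "e \<in> arcs G" "n \<le> d (Inr e)" for e n
  proof -
    have e: "e \<in> {e' \<in> in_arcs G (head G e). n \<le> d (Inr e')}" using that by (simp add: in_arcs_def)
    have "n \<le> d (Inl (head G e))" using that arc_delay_le[of e] by simp
    moreover have "in_arcs G (head G e) \<noteq> {}" using e by blast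
    ultimately show ?thesis using coproduct_inj[OF X e] that(1) by simp
  qed
  \<comment> \<open>The path arcs are the morphisms that turn the legs of one level into those of the next lower one.\<close>
  define Q where "Q v n m \<longleftrightarrow> m \<in> Hom C (X v (Suc n)) (X v n) \<and>
    (\<forall>e\<in>in_arcs G v. Suc n \<le> d (Inr e) \<longrightarrow> m \<cdot> \<iota> v (Suc n) e = \<iota> v n e)" for v n m
  have "\<exists>m. Q v n m" if v: "v \<in> verts G" and n: "n < d (Inl v)" for v n
  proof -
    have ne: "in_arcs G v \<noteq> {}" using n source_delay[OF v] by auto
    have cop_Suc: "is_coproduct C {e \<in> in_arcs G v. Suc n \<le> d (Inr e)} (\<lambda>e. D_vert D (tail G e))
        (X v (Suc n)) (\<iota> v (Suc n))"
      using X[OF v ne] n by simp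
    have z: "X v n \<in> Ob C" using X_Ob[OF v] n by simp
    have inj: "\<iota> v n e \<in> Hom C (D_vert D (tail G e)) (X v n)"
      if "e \<in> {e \<in> in_arcs G v. Suc n \<le> d (Inr e)}" for e
      using \<iota>_Hom[of e n] that by (auto simp: in_arcs_def)
    obtain m where "m \<in> Hom C (X v (Suc n)) (X v n)"
      "\<And>e. e \<in> {e \<in> in_arcs G v. Suc n \<le> d (Inr e)} \<Longrightarrow> m \<cdot> \<iota> v (Suc n) e = \<iota> v n e"
      using coproduct_desc[OF cop_Suc z inj] by blast
    then have "Q v n m" by (simp add: Q_def)
    then show ?thesis ..
  qed
  then obtain m where Q: "Q v n (m v n)" if "v \<in> verts G" "n < d (Inl v)" for v n
    by metis
  have m_Hom: "m v n \<in> Hom C (X v (Suc n)) (X v n)" if "v \<in> verts G" "n < d (Inl v)" for v n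
    using Q[OF that] by (simp add: Q_def)
  have m_\<iota>: "m (head G e) n \<cdot> \<iota> (head G e) (Suc n) e = \<iota> (head G e) n e"
    if "e \<in> arcs G" "n < d (Inr e)" for e n
    using Q[of "head G e" n] that arc_delay_le[of e] by (simp add: Q_def in_arcs_def)
  define E where "E = \<lparr> D_vert = (\<lambda>x\<in>verts H. X (fst x) (snd x)),
    D_arc = (\<lambda>a\<in>arcs H. case a of Inl e \<Rightarrow> \<iota> (head G e) (d (Inr e)) e
      | Inr y \<Rightarrow> m (fst y) (snd y - 1)) \<rparr>"
  have E_vert: "D_vert E (v, n) = X v n" if "v \<in> verts G" "n \<le> d (Inl v)" for v n
    using that by (simp add: E_def)
  have E_Inl: "D_arc E (Inl e) = \<iota> (head G e) (d (Inr e)) e" if "e \<in> arcs G" for e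
    using that by (simp add: E_def)
  have E_Inr: "D_arc E (Inr (v, Suc n)) = m v n" if "v \<in> verts G" "n < d (Inl v)" for v n
    using that by (simp add: E_def)
  have E_arc: "D_arc E a \<in> Hom C (D_vert E (tail H a)) (D_vert E (head H a))" if a: "a \<in> arcs H" for a
  proof (cases a)
    case (Inl e)
    then have e: "e \<in> arcs G" using a by simp
    show ?thesis
      using \<iota>_Hom[OF e order_refl] Inl e arc_delay_le[OF e] by (simp add: E_Inl E_vert X_0)
  next
    case (Inr y)
    then obtain v n where y: "a = Inr (v, Suc n)" and v: "v \<in> verts G" and n: "n < d (Inl v)"
      using a by (cases y; cases "snd y") auto
    then show ?thesis using m_Hom[OF v n] by (simp add: E_Inr E_vert)
  qed
  have "D_vert E \<in> verts H \<rightarrow>\<^sub>E Ob C" using X_Ob by (auto simp: E_def)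
  moreover have "D_arc E \<in> extensional (arcs H)" by (simp add: E_def)
  ultimately have diag: "is_diagram C H E"
    using E_arc by (simp add: is_diagram_def PiE_def)
  have leg: "leg E e n = \<iota> (head G e) n e" if e: "e \<in> arcs G" and n: "n \<le> d (Inr e)" for e n
    using n
  proof (induction rule: inc_induct)
    case base
    show ?case by (simp only: leg_top E_Inl[OF e])
  next
    case (step n)
    have "n < d (Inl (head G e))" using step.hyps arc_delay_le[OF e] by simp
    then show ?case
      using m_\<iota>[OF e step.hyps(2)] step.IH leg_step[OF step.hyps(2), of E] E_Inr[of "head G e" n] e
      by simp
  qed
  have "level_coproduct E v n" if v: "v \<in> verts G" and ne: "in_arcs G v \<noteq> {}" and n: "n \<le> d (Inl v)"
    for v n
  proof -
    have "is_coproduct C {e \<in> in_arcs G v. n \<le> d (Inr e)} (\<lambda>e. D_vert E (tail G e, 0)) (X v n)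
        (\<lambda>e. leg E e n) \<longleftrightarrow>
      is_coproduct C {e \<in> in_arcs G v. n \<le> d (Inr e)} (\<lambda>e. D_vert D (tail G e)) (X v n) (\<iota> v n)"
      by (rule coproduct_cong) (auto simp: in_arcs_def leg E_vert X_0)
    then show ?thesis using X[OF v ne n] E_vert[OF v n] by (simp add: level_coproduct_def)
  qed
  then have "coproduct_condition C H E" using coproduct_condition_H_iff[OF diag] by simp
  then have "E \<in> Ob (Diag_coprod C H)" using diag by (simp add: Ob_Diag_coprod)
  moreover have "collapse E = D"
  proof (rule diagram.equality)
    have "D_vert D \<in> extensional (verts G)" "D_arc D \<in> extensional (arcs G)"
      using D by (simp_all add: is_diagram_def PiE_def)
    then show "D_vert (collapse E) = D_vert D" "D_arc (collapse E) = D_arc D"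
      using E_vert X_0 leg \<iota>_0 by (auto simp: collapse_def extensional_def restrict_def fun_eq_iff)
  qed simp
  ultimately show ?thesis by blast
qed

end

section \<open>The equivalence of diagram categories\<close>

text \<open>A finite nonempty set of naturals attains its supremum, so \<open>d\<close> is as required by the
  locale.\<close>

theorem theorem4p20:
  fixes G :: "('v, 'e) pre_digraph"
    and d :: "'v + 'e \<Rightarrow> nat"
    and C :: "('o, 'm) precategory"
  assumes "wf_digraph G"
    and "verts G \<noteq> {}"
    and "\<And>v. v \<in> verts G \<Longrightarrow> finite (in_arcs G v)"
    and "\<And>v. v \<in> verts G \<Longrightarrow> in_arcs G v \<noteq> {} \<Longrightarrow>
           d (Inl v) = (SUP e\<in>in_arcs G v. d (Inr e))"
    and "\<And>v. v \<in> verts G \<Longrightarrow> in_arcs G v = {} \<Longrightarrow> d (Inl v) = 0"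
    and "category C"
    and "has_binary_coproducts C"
  shows "equivalent_categories (Diag_coprod C G) (Diag_coprod C (in_delay G d))"
proof -
  interpret wf_digraph G by fact
  have Max: "d (Inl v) = Max ((\<lambda>e. d (Inr e)) ` in_arcs G v)"
    if "v \<in> verts G" "in_arcs G v \<noteq> {}" for v
    using assms(4)[OF that] cSup_eq_Max[of "(\<lambda>e. d (Inr e)) ` in_arcs G v"] assms(3)[OF that(1)] that(2)
    by simp
  interpret category_delay C G d
  proof (intro category_delay.intro category_delay_axioms.intro)
    show "d (Inr e) \<le> d (Inl (head G e))" if e: "e \<in> arcs G" for e
    proof -
      have "e \<in> in_arcs G (head G e)" using e by (simp add: in_arcs_def)
      moreover from this have "in_arcs G (head G e) \<noteq> {}" by blast
      ultimately show ?thesis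
        using Max[OF head_in_verts[OF e]] assms(3)[OF head_in_verts[OF e]] by (simp del: in_in_arcs_conv)
    qed
    show "\<exists>e\<in>in_arcs G v. d (Inr e) = d (Inl v)" if "v \<in> verts G" "in_arcs G v \<noteq> {}" for v
    proof -
      have "Max ((\<lambda>e. d (Inr e)) ` in_arcs G v) \<in> (\<lambda>e. d (Inr e)) ` in_arcs G v"
        using assms(3)[OF that(1)] that(2) by (intro Max_in) simp_all
      then show ?thesis unfolding Max[OF that, symmetric] by (elim imageE) (rule bexI, simp_all)
    qed
  qed (fact assms)+
  show ?thesis
    using collapse_functor collapse_fully_faithful collapse_surjective[OF assms(3,7)]
    by (rule equivalent_categories_if_surjective_fully_faithful)
qed

end
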